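(* Let $N$ be an Orlicz function with $N(1)=1$ such that for some $r>0$ $$\inf_{0<s,t\le1}\frac{N(st)}{N(s)t^r}>0,$$ and let $1\le p\le\infty$. The following are equivalent: (i) $\ell^p$ is symmetrically block finitely represented in the unit vector basis $\{e_k\}$ of $l_N$; (ii) $\ell^p$ is symmetrically finitely represented in $l_N$; (iii) $\ell^p$ is crudely symmetrically finitely represented in $l_N$; (iv) $p\in[1/\beta,1/\alpha]$ (with $1/0=\infty$), where $$\alpha=-\lim_{n\to\infty}\frac1n\log_2\sup_{k=0,1,\dots}\frac{N^{-1}(2^{-k-n})}{N^{-1}(2^{-k})},\qquad\beta=\lim_{n\to\infty}\frac1n\log_2\sup_{k\ge n}\frac{N^{-1}(2^{-k+n})}{N^{-1}(2^{-k})}$$ are the Boyd indices of $l_N$.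
   Context: An Orlicz function is an increasing convex continuous function $N$ on $[0,\infty)$ with $N(0)=0$ and $\lim_{t\to\infty}N(t)=\infty$; $N^{-1}$ is its inverse. The Orlicz sequence space $l_N$ consists of real sequences $a$ with $\|a\|_{l_N}=\inf\{u>0:\sum_{k=1}^\infty N(|a_k|/u)\le1\}<\infty$. Sequences $x,y$ have the same ordered distribution if $y_{\pi(k)}=x_k$ for some permutation $\pi$ of $\mathbb N$; finite blocks $\sum_{i=1}^m\alpha_ie_{n_i}$, $\sum_{i=1}^m\beta_ie_{k_i}$ (increasing indices) have the same ordered distribution if $\beta_i=\alpha_{\pi(i)}$ for a permutation $\pi$ of $\{1,\dots,m\}$. $\|a\|_p$ is the $\ell^p$ norm on $\mathbb R^n$ (max norm if $p=\infty$). In a space $X$: $\ell^p$ is symmetrically block finitely represented in $\{e_k\}$ if for all $n,\varepsilon>0$ there are $0=m_0<\dots<m_n$ and reals $\alpha_i$ such that the blocks $u_k=\sum_{i=m_{k-1}+1}^{m_k}\alpha_ie_i$ pairwise have the same ordered distribution and $(1+\varepsilon)^{-1}\|a\|_p\le\|\sum a_ku_k\|_X\le(1+\varepsilon)\|a\|_p$ for all $a\in\mathbb R^n$; symmetrically finitely represented if for all $n,\varepsilon>0$ there are pairwise disjointly supported $x_1,\dots,x_n\in X$ pairwise with the same ordered distribution satisfying the same $(1+\varepsilon)$ estimate; crudely symmetrically finitely represented if for some $C>0$ and every $n$ such $x_k$ exist with $C^{-1}\|a\|_p\le\|\sum a_kx_k\|_X\le C\|a\|_p$. *)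

theory Defs
  imports "HOL-Analysis.Analysis" "HOL-Library.Extended_Real"
begin

text \<open>Sequences are functions nat => real; the paper's coordinate a_k (k >= 1)
  corresponds to index k - 1 here, e_i is the i-th unit vector (index from 0).\<close>

definition orlicz_function :: "(real \<Rightarrow> real) \<Rightarrow> bool" where
  "orlicz_function N \<longleftrightarrow>
     mono_on {0..} N \<and> convex_on {0..} N \<and> continuous_on {0..} N \<and>
     N 0 = 0 \<and> filterlim N at_top at_top"

definition orlicz_inv :: "(real \<Rightarrow> real) \<Rightarrow> real \<Rightarrow> real" where
  "orlicz_inv N u = (THE t. 0 \<le> t \<and> N t = u)"

definition orlicz_admissible :: "(real \<Rightarrow> real) \<Rightarrow> (nat \<Rightarrow> real) \<Rightarrow> real set" where
  "orlicz_admissible N a =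
     {u. u > 0 \<and> summable (\<lambda>k. N (\<bar>a k\<bar> / u)) \<and> (\<Sum>k. N (\<bar>a k\<bar> / u)) \<le> 1}"

definition in_orlicz :: "(real \<Rightarrow> real) \<Rightarrow> (nat \<Rightarrow> real) \<Rightarrow> bool" where
  "in_orlicz N a \<longleftrightarrow> orlicz_admissible N a \<noteq> {}"

definition orlicz_norm :: "(real \<Rightarrow> real) \<Rightarrow> (nat \<Rightarrow> real) \<Rightarrow> real" where
  "orlicz_norm N a = Inf (orlicz_admissible N a)"

definition lp_norm :: "ereal \<Rightarrow> nat \<Rightarrow> (nat \<Rightarrow> real) \<Rightarrow> real" where
  "lp_norm p n a =
     (if p = \<infinity> then Max (insert 0 ((\<lambda>k. \<bar>a k\<bar>) ` {1..n}))
      else (\<Sum>k\<in>{1..n}. \<bar>a k\<bar> powr real_of_ereal p) powr (1 / real_of_ereal p))"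

definition same_ordered_dist :: "(nat \<Rightarrow> real) \<Rightarrow> (nat \<Rightarrow> real) \<Rightarrow> bool" where
  "same_ordered_dist x y \<longleftrightarrow> (\<exists>\<pi>. bij \<pi> \<and> (\<forall>k. y (\<pi> k) = x k))"

definition disjoint_supp :: "(nat \<Rightarrow> real) \<Rightarrow> (nat \<Rightarrow> real) \<Rightarrow> bool" where
  "disjoint_supp x y \<longleftrightarrow> (\<forall>i. x i = 0 \<or> y i = 0)"

definition block_vec :: "(nat \<Rightarrow> nat) \<Rightarrow> (nat \<Rightarrow> real) \<Rightarrow> nat \<Rightarrow> nat \<Rightarrow> real" where
  "block_vec m \<alpha> k = (\<lambda>i. if m (k - 1) \<le> i \<and> i < m k then \<alpha> i else 0)"

definition blocks_same_ordered_dist ::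
    "(nat \<Rightarrow> nat) \<Rightarrow> (nat \<Rightarrow> real) \<Rightarrow> nat \<Rightarrow> nat \<Rightarrow> bool" where
  "blocks_same_ordered_dist m \<alpha> j k \<longleftrightarrow>
     m k - m (k - 1) = m j - m (j - 1) \<and>
     (\<exists>\<pi>. \<pi> permutes {0..<m j - m (j - 1)} \<and>
          (\<forall>i < m j - m (j - 1). \<alpha> (m (k - 1) + i) = \<alpha> (m (j - 1) + \<pi> i)))"

definition lin_comb :: "nat \<Rightarrow> (nat \<Rightarrow> real) \<Rightarrow> (nat \<Rightarrow> nat \<Rightarrow> real) \<Rightarrow> nat \<Rightarrow> real" where
  "lin_comb n a x = (\<lambda>i. \<Sum>k\<in>{1..n}. a k * x k i)"

definition sym_block_fin_rep :: "(real \<Rightarrow> real) \<Rightarrow> ereal \<Rightarrow> bool" where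
  "sym_block_fin_rep N p \<longleftrightarrow>
     (\<forall>n \<ge> 1. \<forall>\<epsilon> > 0. \<exists>m \<alpha>. m 0 = 0 \<and> (\<forall>k \<in> {1..n}. m (k - 1) < m k) \<and>
        (\<forall>j \<in> {1..n}. \<forall>k \<in> {1..n}. blocks_same_ordered_dist m \<alpha> j k) \<and>
        (\<forall>a. lp_norm p n a / (1 + \<epsilon>) \<le> orlicz_norm N (lin_comb n a (block_vec m \<alpha>)) \<and>
             orlicz_norm N (lin_comb n a (block_vec m \<alpha>)) \<le> (1 + \<epsilon>) * lp_norm p n a))"

definition sym_fin_rep :: "(real \<Rightarrow> real) \<Rightarrow> ereal \<Rightarrow> bool" where
  "sym_fin_rep N p \<longleftrightarrow>
     (\<forall>n \<ge> 1. \<forall>\<epsilon> > 0. \<exists>x :: nat \<Rightarrow> nat \<Rightarrow> real.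
        (\<forall>k \<in> {1..n}. in_orlicz N (x k)) \<and>
        (\<forall>j \<in> {1..n}. \<forall>k \<in> {1..n}. j \<noteq> k \<longrightarrow> disjoint_supp (x j) (x k)) \<and>
        (\<forall>j \<in> {1..n}. \<forall>k \<in> {1..n}. same_ordered_dist (x j) (x k)) \<and>
        (\<forall>a. lp_norm p n a / (1 + \<epsilon>) \<le> orlicz_norm N (lin_comb n a x) \<and>
             orlicz_norm N (lin_comb n a x) \<le> (1 + \<epsilon>) * lp_norm p n a))"

definition crude_sym_fin_rep :: "(real \<Rightarrow> real) \<Rightarrow> ereal \<Rightarrow> bool" where
  "crude_sym_fin_rep N p \<longleftrightarrow>
     (\<exists>C > 0. \<forall>n \<ge> 1. \<exists>x :: nat \<Rightarrow> nat \<Rightarrow> real.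
        (\<forall>k \<in> {1..n}. in_orlicz N (x k)) \<and>
        (\<forall>j \<in> {1..n}. \<forall>k \<in> {1..n}. j \<noteq> k \<longrightarrow> disjoint_supp (x j) (x k)) \<and>
        (\<forall>j \<in> {1..n}. \<forall>k \<in> {1..n}. same_ordered_dist (x j) (x k)) \<and>
        (\<forall>a. lp_norm p n a / C \<le> orlicz_norm N (lin_comb n a x) \<and>
             orlicz_norm N (lin_comb n a x) \<le> C * lp_norm p n a))"

definition boyd_alpha :: "(real \<Rightarrow> real) \<Rightarrow> real" where
  "boyd_alpha N = - lim (\<lambda>n::nat. (1 / real n) * log 2
      (SUP k\<in>(UNIV::nat set). orlicz_inv N (2 powr (- real k - real n)) / orlicz_inv N (2 powr (- real k))))"

definition boyd_beta :: "(real \<Rightarrow> real) \<Rightarrow> real" where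
  "boyd_beta N = lim (\<lambda>n::nat. (1 / real n) * log 2
      (SUP k\<in>{n..}. orlicz_inv N (2 powr (- real k + real n)) / orlicz_inv N (2 powr (- real k))))"

definition recip_ereal :: "real \<Rightarrow> ereal" where
  "recip_ereal x = (if x = 0 then \<infinity> else ereal (1 / x))"

end

(*
  Put G(j) = N(rho^j) / rho^(jp). For (iv) => (i): if every sum of G over an interval [a,b) far
  out were bounded by a multiple of G(a) + G(b), then G would decay or grow geometrically, so that
  N(st) <= A t^q N(s) for some q > p, or N(st) >= A t^q N(s) for some q < p, and 1/p would lie
  strictly outside [alpha, beta]. Hence some interval has a sum S dominating its end terms, and
  F(t) = sum over a <= j < b of floor(rho^(-jp) / S) N(t rho^j) satisfies F(rho t) ~ rho^p F(t)
  up to boundary terms: it is uniformly close to t^p on [0,1]. Here F is the modular of a finitely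
  supported vector, and by convexity its disjoint copies span an almost isometric copy of l^p.

  For (iii) => (iv): let F be the modular of x_1. Testing the equivalence on (1,...,1) and e_1 shows
  that F(n^(-1/p)) is of order 1/n up to dilation of the argument by a constant, while power bounds
  on N pass to F; these are incompatible unless 1/p lies in [alpha, beta].
*)

theory Submission
  imports Defs
begin

text \<open>The Boyd indices enter only through power estimates on the unit square. An exponent
  strictly below 1/beta (above 1/alpha) gives an upper (lower) estimate, and the converse loses only
  the endpoint. The loss is harmless: the interval in (iv) is closed, so only exponents strictly on
  the wrong side of p are ever tested.

  The hypothesis on N is itself a lower estimate with exponent r. It forces alpha > 0, which
  excludes p = infinity from (iv), and it bounds N(Mz)/N(z) for z in (0,1]. That bound keeps the
  modular of every vector of l_N finite at all scales and absorbs the constant of (iii).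

  Two errors shape (iv) => (i). The multiplicity of rho^j must be an integer; since N(x) <= x on
  [0,1], rounding down costs at most the sum of the rho^j, a geometric tail, which is why the
  interval lies far out. And replacing t by rho^h t shifts the interval by h places, exchanging h
  terms at each end; only boundedly many h matter, because below some rho^H both sides are already
  small. So it is enough that the end terms are small against the sum by a factor fixed
  beforehand.\<close>

section \<open>Growth of sequences\<close>

lemma subadditive_mult_bound:
  fixes a :: "nat \<Rightarrow> real"
  assumes sub: "\<And>m n. a (m + n) \<le> a m + a n"
  shows "a (q * m + s) \<le> real q * a m + a s"
proof (induction q)
  case (Suc q)
  have "a (Suc q * m + s) = a (m + (q * m + s))" by (simp add: algebra_simps)
  also have "\<dots> \<le> a m + a (q * m + s)" by (rule sub)
  also have "\<dots> \<le> real (Suc q) * a m + a s" using Suc by (simp add: algebra_simps)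
  finally show ?case .
qed simp

text \<open>Fekete's lemma: the quotients converge to their infimum, which the linear lower bound
  keeps finite. It is needed because the Boyd indices are defined with \<open>lim\<close>, which
  says nothing about a divergent sequence.\<close>

lemma fekete_convergent:
  fixes a :: "nat \<Rightarrow> real"
  assumes sub: "\<And>m n. a (m + n) \<le> a m + a n" and lower: "\<And>n. - B * real n \<le> a n"
  shows "convergent (\<lambda>n. a n / real n)"
proof -
  define L where "L = (INF n\<in>{1..}. a n / real n)"
  have bdd: "bdd_below ((\<lambda>n. a n / real n) ` {1..})"
    using lower by (intro bdd_belowI[where m = "- B"]) (auto simp: field_simps)
  have low: "L \<le> a n / real n" if "n \<ge> 1" for n
    unfolding L_def using bdd that by (intro cINF_lower) auto
  have "(\<lambda>n. a n / real n) \<longlonglongrightarrow> L"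
  proof (rule LIMSEQ_I)
    fix e :: real assume e: "0 < e"
    have "\<exists>m\<in>{1..}. a m / real m < L + e / 2"
      using e bdd by (subst cINF_less_iff[symmetric]) (auto simp: L_def)
    then obtain m where m: "m \<ge> 1" "a m / real m < L + e / 2" by auto
    \<comment> \<open>Bounds, independently of \<open>n\<close>, what division by \<open>m\<close>
      leaves over: the value \<open>a s\<close> at the remainder and the fraction s/m of
      \<open>a m\<close>.\<close>
    define K where "K = (\<Sum>s<m. \<bar>a s\<bar>) + \<bar>a m\<bar>"
    have up: "a n / real n \<le> a m / real m + K / real n" if n: "n \<ge> 1" for n
    proof -
      define q s where "q = n div m" and "s = n mod m"
      have s: "s < m" using m by (simp add: s_def)
      have ns: "n = q * m + s" by (simp add: q_def s_def)
      have a_n: "a n \<le> real q * a m + a s" unfolding ns by (rule subadditive_mult_bound[OF sub])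
      have "real q * a m = (real n - real s) * (a m / real m)"
        using ns m by (simp add: field_simps)
      also have "\<dots> = real n * (a m / real m) - (real s / real m) * a m"
        by (simp add: left_diff_distrib diff_divide_distrib)
      also have "\<dots> \<le> real n * (a m / real m) + \<bar>a m\<bar>"
      proof -
        have "\<bar>(real s / real m) * a m\<bar> \<le> 1 * \<bar>a m\<bar>"
          unfolding abs_mult using s by (intro mult_right_mono) auto
        then show ?thesis by linarith
      qed
      finally have qa: "real q * a m \<le> real n * (a m / real m) + \<bar>a m\<bar>" .
      have "a s \<le> (\<Sum>s<m. \<bar>a s\<bar>)"
        using s by (intro order_trans[OF abs_ge_self member_le_sum[where f = "\<lambda>s. \<bar>a s\<bar>"]]) auto
      from order_trans[OF a_n add_mono[OF qa this]]
      have "a n \<le> real n * (a m / real m) + K" unfolding K_def by (simp only: add_ac)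
      then have "a n / real n \<le> (real n * (a m / real m) + K) / real n"
        by (intro divide_right_mono) auto
      also have "\<dots> = a m / real m + K / real n" using n by (simp add: add_divide_distrib)
      finally show ?thesis .
    qed
    obtain n0 where n0: "real n0 > 2 * K / e" using reals_Archimedean2 by blast
    show "\<exists>no. \<forall>n\<ge>no. norm (a n / real n - L) < e"
    proof (intro exI allI impI)
      fix n assume n: "n0 + 1 \<le> n"
      have "2 * K < e * real n0" using n0 e by (simp add: field_simps)
      also have "\<dots> \<le> e * real n" using n e by simp
      finally have Kn: "K / real n < e / 2" using n by (simp add: field_simps)
      have "1 \<le> n" using n by simp
      from up[OF this] low[OF this] Kn m(2) e
      have "\<bar>a n / real n - L\<bar> < e" by linarith
      then show "norm (a n / real n - L) < e" by simp
    qed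
  qed
  then show ?thesis by (auto simp: convergent_def)
qed

text \<open>\<open>M\<close> is submultiplicative, so Fekete's lemma applies to its logarithm; the
  step bounds keep \<open>M\<close> finite and positive. Applied to N^(-1)(2^(-k)) the index
  \<open>L\<close> is -alpha, applied to the reciprocals it is beta. The strict inequality in the
  first claim leaves room for the limit to take effect; in the second the constant \<open>A\<close>
  vanishes after division by \<open>n\<close>.\<close>

lemma growth_index:
  fixes f :: "nat \<Rightarrow> real"
  assumes pos: "\<And>k. 0 < f k" and b: "0 < b"
    and step: "\<And>k. b * f k \<le> f (Suc k)" "\<And>k. f (Suc k) \<le> B * f k"
  defines "M \<equiv> \<lambda>n. SUP k. f (k + n) / f k"
  defines "L \<equiv> lim (\<lambda>n. (1 / real n) * log 2 (M n))"
  shows "L < l \<Longrightarrow> \<exists>A>0. \<forall>k n. f (k + n) \<le> A * 2 powr (l * real n) * f k"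
    and "0 < A \<Longrightarrow> \<forall>k n. f (k + n) \<le> A * 2 powr (l * real n) * f k \<Longrightarrow> L \<le> l"
proof -
  have B: "0 < B" using pos[of 1] pos[of 0] step(2)[of 0]
    by (metis One_nat_def less_le_trans zero_less_mult_pos2)
  have lo: "b ^ n * f k \<le> f (k + n)" for k n
  proof (induction n)
    case (Suc n)
    have "b ^ Suc n * f k \<le> b * f (k + n)" using Suc b by (simp add: mult.assoc)
    also have "\<dots> \<le> f (k + Suc n)" using step(1) by simp
    finally show ?case .
  qed simp
  have hi: "f (k + n) \<le> B ^ n * f k" for k n
  proof (induction n)
    case (Suc n)
    have "f (k + Suc n) \<le> B * f (k + n)" using step(2) by simp
    also have "\<dots> \<le> B ^ Suc n * f k" using Suc B by (simp add: mult.assoc)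
    finally show ?case .
  qed simp
  have bdd: "bdd_above (range (\<lambda>k. f (k + n) / f k))" for n
    using hi pos by (intro bdd_aboveI[where M = "B ^ n"]) (auto simp: field_simps)
  have le_M: "f (k + n) \<le> M n * f k" for k n
  proof -
    have "f (k + n) / f k \<le> M n" unfolding M_def using bdd by (intro cSUP_upper) auto
    then show ?thesis using pos[of k] by (simp add: field_simps)
  qed
  have M_le: "M n \<le> x" if "\<And>k. f (k + n) \<le> x * f k" for n x
    unfolding M_def using that pos by (intro cSUP_least) (auto simp: field_simps)
  have M_ge: "b ^ n \<le> M n" for n
    using order_trans[OF lo le_M, of n 0] pos[of 0] by simp
  have M_pos: "0 < M n" for n using M_ge[of n] b by (meson less_le_trans zero_less_power)
  have M_mult: "M (m + n) \<le> M m * M n" for m n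
  proof (rule M_le)
    fix k
    have "f (k + m + n) \<le> M n * f (k + m)" by (rule le_M)
    also have "\<dots> \<le> M n * (M m * f k)" using le_M M_pos by (intro mult_left_mono) (auto simp: less_imp_le)
    finally show "f (k + (m + n)) \<le> M m * M n * f k" by (simp add: algebra_simps)
  qed
  have "convergent (\<lambda>n. log 2 (M n) / real n)"
  proof (rule fekete_convergent)
    show "log 2 (M (m + n)) \<le> log 2 (M m) + log 2 (M n)" for m n
    proof -
      have "log 2 (M (m + n)) \<le> log 2 (M m * M n)" using M_mult[of m n] M_pos by simp
      also have "\<dots> = log 2 (M m) + log 2 (M n)" using M_pos[of m] M_pos[of n] by (simp add: log_mult)
      finally show ?thesis .
    qed
    show "- (- log 2 b) * real n \<le> log 2 (M n)" for n
    proof -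
      have "log 2 (b ^ n) \<le> log 2 (M n)" using M_ge[of n] b M_pos[of n] by simp
      then show ?thesis using b by (simp add: log_nat_power mult.commute)
    qed
  qed
  then have lim: "(\<lambda>n. (1 / real n) * log 2 (M n)) \<longlonglongrightarrow> L"
    unfolding L_def by (simp add: convergent_LIMSEQ_iff)
  show "\<exists>A>0. \<forall>k n. f (k + n) \<le> A * 2 powr (l * real n) * f k" if "L < l"
  proof -
    have "\<forall>\<^sub>F n in sequentially. (1 / real n) * log 2 (M n) < l"
      using lim that by (rule order_tendstoD(2))
    then obtain n0 where n0: "\<And>n. n \<ge> n0 \<Longrightarrow> (1 / real n) * log 2 (M n) < l"
      by (auto simp: eventually_sequentially)
    \<comment> \<open>The sum pays for the crude bound B^n at the finitely many n <= n0; beyond them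
      the constant 1 would do.\<close>
    define A where "A = 1 + (\<Sum>n\<le>n0. B ^ n / 2 powr (l * real n))"
    have A: "0 < A" "1 \<le> A" unfolding A_def using B by (auto intro!: add_pos_nonneg sum_nonneg)
    have "f (k + n) \<le> A * 2 powr (l * real n) * f k" for k n
    proof (cases "n \<le> n0")
      case True
      have "B ^ n / 2 powr (l * real n) \<le> (\<Sum>n\<le>n0. B ^ n / 2 powr (l * real n))"
        using True B by (intro member_le_sum[where f = "\<lambda>n. B ^ n / 2 powr (l * real n)"]) auto
      then have "B ^ n / 2 powr (l * real n) \<le> A" unfolding A_def by simp
      then have "B ^ n \<le> A * 2 powr (l * real n)" by (simp add: field_simps)
      then show ?thesis using hi[of k n] pos[of k] by (meson less_imp_le mult_right_mono order_trans)
    next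
      case False
      then have "log 2 (M n) < l * real n" using n0[of n] by (simp add: field_simps)
      then have "M n \<le> 2 powr (l * real n)" using M_pos[of n] by (simp add: log_less_iff less_imp_le)
      also have "\<dots> \<le> A * 2 powr (l * real n)" using A by simp
      finally show ?thesis using le_M[of k n] pos[of k]
        by (meson less_imp_le mult_right_mono order_trans)
    qed
    then show ?thesis using A by blast
  qed
  show "L \<le> l" if A: "0 < A" and *: "\<forall>k n. f (k + n) \<le> A * 2 powr (l * real n) * f k"
  proof -
    have "(\<lambda>n. l + log 2 A * (1 / real n)) \<longlonglongrightarrow> l + log 2 A * 0"
      by (intro tendsto_intros lim_1_over_n)
    moreover have "\<forall>\<^sub>F n in sequentially. (1 / real n) * log 2 (M n) \<le> l + log 2 A * (1 / real n)"
    proof (rule eventually_sequentiallyI[of 1])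
      fix n :: nat assume n: "1 \<le> n"
      have "M n \<le> A * 2 powr (l * real n)" using * by (intro M_le) auto
      then have "log 2 (M n) \<le> log 2 (A * 2 powr (l * real n))" using M_pos[of n] A by simp
      also have "\<dots> = log 2 A + l * real n" using A by (simp add: log_mult)
      finally show "(1 / real n) * log 2 (M n) \<le> l + log 2 A * (1 / real n)"
        using n by (simp add: field_simps)
    qed
    ultimately show ?thesis using lim by (intro LIMSEQ_le) (auto simp: eventually_sequentially)
  qed
qed

text \<open>If \<open>G\<close> comes arbitrarily close to 0 far out, the right end term can be made
  to disappear: tail sums satisfy T(a) <= L G(a), so each step removes a fixed fraction of T.
  Otherwise \<open>G\<close> stays away from 0, long sums are large, the left end term is absorbed
  by the right one, and the partial sums U(b) <= 2 L G(b) grow by a fixed factor at each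
  step.\<close>

lemma doubly_dominated_sums_dichotomy:
  fixes G :: "nat \<Rightarrow> real"
  assumes pos: "\<And>j. 0 < G j" and L: "1 < L"
    and dom: "\<And>a b. a0 \<le> a \<Longrightarrow> a < b \<Longrightarrow> (\<Sum>j=a..<b. G j) \<le> L * (G a + G b)"
  obtains b0 A \<theta> where "0 < A" "0 < \<theta>" "\<theta> < 1" "\<And>i j. b0 \<le> i \<Longrightarrow> i \<le> j \<Longrightarrow> G j \<le> A * \<theta> ^ (j - i) * G i"
  | b0 A \<theta> where "0 < A" "0 < \<theta>" "\<theta> < 1" "\<And>i j. b0 \<le> i \<Longrightarrow> i \<le> j \<Longrightarrow> G i \<le> A * \<theta> ^ (j - i) * G j"
proof (cases "\<forall>e>0. \<forall>n. \<exists>b\<ge>n. G b < e")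
  case True
  have sum_le: "(\<Sum>j=a..<b. G j) \<le> L * G a" if a: "a0 \<le> a" for a b
  proof (rule field_le_epsilon)
    fix e :: real assume e: "0 < e"
    obtain c where c: "c \<ge> max b (Suc a)" "G c < e / L" using True e L by (meson divide_pos_pos less_trans zero_less_one)
    have "(\<Sum>j=a..<b. G j) \<le> (\<Sum>j=a..<c. G j)"
      using c pos by (intro sum_mono2) (auto simp: less_imp_le)
    also have "\<dots> \<le> L * (G a + G c)" using a c by (intro dom) auto
    also have "\<dots> \<le> L * G a + e" using c L by (simp add: field_simps)
    finally show "(\<Sum>j=a..<b. G j) \<le> L * G a + e" .
  qed
  \<comment> \<open>The sum of the whole tail, finite by \<open>sum_le\<close>.\<close>
  define T where "T a = (SUP b. \<Sum>j=a..<b. G j)" for a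
  have bdd: "bdd_above (range (\<lambda>b. \<Sum>j=a..<b. G j))" if "a0 \<le> a" for a
    using sum_le[OF that] by (intro bdd_aboveI) auto
  have T_le: "T a \<le> L * G a" if "a0 \<le> a" for a
    unfolding T_def using sum_le[OF that] by (intro cSUP_least) auto
  have T_ge: "G a + T (Suc a) \<le> T a" if a: "a0 \<le> a" for a
  proof -
    have "T (Suc a) \<le> T a - G a"
      unfolding T_def[of "Suc a"]
    proof (rule cSUP_least)
      fix b
      have "(\<Sum>j=a..<max b (Suc a). G j) \<le> T a"
        unfolding T_def using bdd[OF a] by (intro cSUP_upper) auto
      moreover have "(\<Sum>j=a..<max b (Suc a). G j) = G a + (\<Sum>j=Suc a..<max b (Suc a). G j)"
        by (intro sum.atLeast_Suc_lessThan) auto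
      moreover have "(\<Sum>j=Suc a..<max b (Suc a). G j) = (\<Sum>j=Suc a..<b. G j)"
        by (auto simp: max_def)
      ultimately show "(\<Sum>j=Suc a..<b. G j) \<le> T a - G a" by simp
    qed simp
    then show ?thesis by simp
  qed
  have T_nonneg: "0 \<le> T a" if "a0 \<le> a" for a
  proof -
    have "(\<Sum>j=a..<a. G j) \<le> T a"
      unfolding T_def using bdd[OF that] by (intro cSUP_upper) auto
    then show ?thesis by simp
  qed
  define \<theta> where "\<theta> = 1 - 1 / L"
  have \<theta>: "0 < \<theta>" "\<theta> < 1" unfolding \<theta>_def using L by auto
  have T_step: "T (Suc a) \<le> \<theta> * T a" if "a0 \<le> a" for a
  proof -
    have "T a / L \<le> G a" using T_le[OF that] L by (simp add: field_simps)
    then show ?thesis using T_ge[OF that] by (simp add: \<theta>_def algebra_simps)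
  qed
  have T_decay: "T (i + n) \<le> \<theta> ^ n * T i" if "a0 \<le> i" for i n
  proof (induction n)
    case (Suc n)
    have "T (i + Suc n) \<le> \<theta> * T (i + n)" using T_step[of "i + n"] that by simp
    also have "\<dots> \<le> \<theta> * (\<theta> ^ n * T i)" using Suc \<theta> by (intro mult_left_mono) auto
    finally show ?case by simp
  qed simp
  show ?thesis
  proof (rule that(1))
    fix i j assume ij: "a0 \<le> i" "i \<le> j"
    have "G j \<le> T j" using T_ge[of j] T_nonneg[of "Suc j"] ij by simp
    also have "\<dots> \<le> \<theta> ^ (j - i) * T i" using T_decay[of i "j - i"] ij by simp
    also have "\<dots> \<le> \<theta> ^ (j - i) * (L * G i)" using T_le ij \<theta> by (intro mult_left_mono) auto
    finally show "G j \<le> L * \<theta> ^ (j - i) * G i" by (simp add: algebra_simps)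
  qed (use L \<theta> in auto)
next
  case False
  then obtain e n0 where e: "0 < e" "\<And>b. b \<ge> n0 \<Longrightarrow> e \<le> G b" by (auto simp: not_less)
  define U where "U b = (\<Sum>j=a0..<b. G j)" for b
  have "\<exists>b0\<ge>Suc a0. \<forall>b\<ge>b0. G a0 \<le> G b"
  proof -
    \<comment> \<open>With \<open>m\<close> terms of size at least \<open>e\<close> the sum exceeds
      2 L G(a0), so its bound L (G(a0) + G(b)) forces G(a0) < G(b).\<close>
    obtain m :: nat where m: "real m > 2 * L * G a0 / e" using reals_Archimedean2 by blast
    have "G a0 \<le> G b" if b: "b \<ge> Suc (max a0 n0 + m)" for b
    proof -
      have "2 * L * G a0 < real m * e" using m e by (simp add: field_simps)
      also have "real m * e \<le> (\<Sum>j=max a0 n0..<max a0 n0 + m. G j)"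
        using sum_mono[of "{max a0 n0..<max a0 n0 + m}" "\<lambda>_. e" G] e by simp
      also have "\<dots> \<le> (\<Sum>j=a0..<b. G j)"
        using b pos by (intro sum_mono2) (auto simp: less_imp_le)
      also have "\<dots> \<le> L * (G a0 + G b)" using b by (intro dom) auto
      finally have "L * G a0 < L * G b" by (simp add: algebra_simps)
      then show ?thesis using L by simp
    qed
    then show ?thesis by (intro exI[of _ "Suc (max a0 n0 + m)"]) auto
  qed
  then obtain b0 where b0: "b0 \<ge> Suc a0" "\<And>b. b \<ge> b0 \<Longrightarrow> G a0 \<le> G b" by blast
  have U_le: "U b \<le> 2 * L * G b" if b: "b \<ge> b0" for b
  proof -
    have "U b \<le> L * (G a0 + G b)" unfolding U_def using b b0 by (intro dom) auto
    also have "\<dots> \<le> L * (G b + G b)" using b0(2)[OF b] L by simp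
    finally show ?thesis by simp
  qed
  have U_Suc: "U (Suc b) = U b + G b" if "b \<ge> b0" for b
    using that b0 unfolding U_def by simp
  have U_nonneg: "0 \<le> U b" for b unfolding U_def using pos by (intro sum_nonneg) (auto simp: less_imp_le)
  define \<theta> where "\<theta> = 1 / (1 + 1 / (2 * L))"
  have \<theta>: "0 < \<theta>" "\<theta> < 1" unfolding \<theta>_def using L by (auto simp: field_simps add_pos_pos)
  have U_step: "U b \<le> \<theta> * U (Suc b)" if "b \<ge> b0" for b
  proof -
    have "U b / (2 * L) \<le> G b" using U_le[OF that] L by (simp add: field_simps)
    then have "U b * (1 + 1 / (2 * L)) \<le> U (Suc b)" using U_Suc[OF that] by (simp add: algebra_simps)
    then show ?thesis unfolding \<theta>_def using L by (simp add: field_simps add_pos_pos)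
  qed
  have U_growth: "U i \<le> \<theta> ^ n * U (i + n)" if "b0 \<le> i" for i n
  proof (induction n)
    case (Suc n)
    have "U i \<le> \<theta> ^ n * U (i + n)" by (rule Suc)
    also have "\<dots> \<le> \<theta> ^ n * (\<theta> * U (Suc (i + n)))" using U_step[of "i + n"] that \<theta> by (intro mult_left_mono) auto
    finally show ?case by (simp add: algebra_simps)
  qed simp
  show ?thesis
  proof (rule that(2))
    fix i j assume ij: "b0 \<le> i" "i \<le> j"
    have "G i \<le> U (Suc i)" using U_Suc U_nonneg ij by simp
    also have "\<dots> \<le> \<theta> ^ (j - i) * U (Suc i + (j - i))" using U_growth[of "Suc i" "j - i"] ij by simp
    also have "U (Suc i + (j - i)) = U (Suc j)" using ij by simp
    also have "U (Suc j) \<le> (2 * L + 1) * G j" using U_Suc[of j] U_le[of j] ij by (simp add: algebra_simps)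
    finally show "G i \<le> (2 * L + 1) * \<theta> ^ (j - i) * G j" using \<theta> by (simp add: algebra_simps)
  qed (use L \<theta> in auto)
qed

lemma power_bracket:
  fixes \<rho> t :: real
  assumes \<rho>: "0 < \<rho>" "\<rho> < 1" and t: "0 < t" "t \<le> 1"
  obtains i where "\<rho> ^ Suc i < t" "t \<le> \<rho> ^ i"
proof -
  have ex: "\<exists>n. \<rho> ^ n < t" using real_arch_pow_inv[OF t(1) \<rho>(2)] .
  define n where "n = (LEAST n. \<rho> ^ n < t)"
  have n: "\<rho> ^ n < t" unfolding n_def using ex by (rule LeastI_ex)
  then have "n \<noteq> 0" using t by (intro notI) auto
  then obtain i where i: "n = Suc i" by (cases n) auto
  have "\<not> \<rho> ^ i < t" using not_less_Least[of i "\<lambda>n. \<rho> ^ n < t"] i by (simp add: n_def)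
  then show ?thesis using that[of i] n i by auto
qed

lemma sum_geometric_tail_le:
  fixes \<rho> :: real
  assumes "0 < \<rho>" "\<rho> < 1"
  shows "(\<Sum>j=a..<b. \<rho> ^ j) \<le> \<rho> ^ a / (1 - \<rho>)"
proof (cases "a \<le> b")
  case True
  then have "(\<Sum>j=a..<b. \<rho> ^ j) * (1 - \<rho>) = \<rho> ^ a - \<rho> ^ b"
  proof (induction b rule: dec_induct)
    case (step n)
    then show ?case by (simp add: distrib_right) (simp add: algebra_simps)
  qed simp
  then have "(\<Sum>j=a..<b. \<rho> ^ j) * (1 - \<rho>) \<le> \<rho> ^ a" using assms by simp
  then show ?thesis using assms by (simp add: field_simps)
qed (use assms in simp)

text \<open>The dichotomy controls \<open>G\<close> only far out, whereas power estimates concern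
  all of (0,1]. Lowering the threshold by one index changes only the constant.\<close>

lemma eventual_geometric_bound_global:
  fixes G :: "nat \<Rightarrow> real"
  assumes pos: "\<And>j. 0 < G j" and \<theta>: "0 < \<theta>"
    and ev: "\<exists>A>0. \<forall>i n. b0 \<le> i \<longrightarrow> G (i + n) \<le> A * \<theta> ^ n * G i"
  shows "\<exists>A>0. \<forall>i n. G (i + n) \<le> A * \<theta> ^ n * G i"
  using ev
proof (induction b0)
  case (Suc b0)
  then obtain A where A: "0 < A" "\<And>i n. Suc b0 \<le> i \<Longrightarrow> G (i + n) \<le> A * \<theta> ^ n * G i" by blast
  \<comment> \<open>The quotient serves a start at \<open>b0\<close>: moving to
    \<open>Suc b0\<close> costs the ratio of the two values and one power of
    \<open>\<theta>\<close>. The 1 serves n = 0.\<close>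
  define B where "B = A + 1 + A * G (Suc b0) / (\<theta> * G b0)"
  have q: "0 \<le> A * G (Suc b0) / (\<theta> * G b0)" using A \<theta> pos by (simp add: less_imp_le)
  have B: "0 < B" "1 \<le> B" "A \<le> B" "A * G (Suc b0) / (\<theta> * G b0) \<le> B"
    using A q unfolding B_def by linarith+
  have "G (i + n) \<le> B * \<theta> ^ n * G i" if i: "b0 \<le> i" for i n
  proof (cases "i = b0")
    case True
    show ?thesis
    proof (cases n)
      case 0
      then show ?thesis using B pos[of i] by simp
    next
      case (Suc m)
      have "G (i + n) \<le> A * \<theta> ^ m * G (Suc b0)" using A(2)[of "Suc b0" m] True Suc by simp
      also have "\<dots> = (A * G (Suc b0) / (\<theta> * G b0)) * \<theta> ^ n * G i"
        using True Suc \<theta> pos[of b0] by simp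
      also have "\<dots> \<le> B * \<theta> ^ n * G i"
        using B \<theta> pos[of i] by (intro mult_right_mono) auto
      finally show ?thesis .
    qed
  next
    case False
    then have "G (i + n) \<le> A * \<theta> ^ n * G i" using A(2) i by simp
    also have "\<dots> \<le> B * \<theta> ^ n * G i" using B \<theta> pos[of i] by (intro mult_right_mono) auto
    finally show ?thesis .
  qed
  then show ?case using Suc.IH B by blast
qed simp

lemma sum_list_concat_replicate:
  fixes f :: "'a \<Rightarrow> real"
  shows "(\<Sum>x\<leftarrow>concat (map (\<lambda>j. replicate (d j) (g j)) js). f x) = (\<Sum>j\<leftarrow>js. real (d j) * f (g j))"
  by (induction js) (simp_all add: sum_list_replicate)

lemma power_eq_powr_log:
  fixes \<rho> \<theta> :: real
  assumes "0 < \<rho>" "\<rho> < 1" "0 < \<theta>"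
  shows "\<theta> ^ n = (\<rho> ^ n) powr (log \<rho> \<theta>)"
proof -
  have "(\<rho> ^ n) powr (log \<rho> \<theta>) = (\<rho> powr real n) powr (log \<rho> \<theta>)"
    using assms by (simp add: powr_realpow)
  also have "\<dots> = (\<rho> powr (log \<rho> \<theta>)) powr real n"
    by (simp only: powr_powr mult.commute)
  finally show ?thesis using assms by (simp add: powr_realpow)
qed

lemma exists_powr_gt:
  fixes s K :: real
  assumes "0 < s"
  shows "\<exists>n0::nat. \<forall>n\<ge>n0. K < real n powr s"
proof -
  have "filterlim (\<lambda>n. real n powr s) at_top sequentially"
    using assms by (intro filterlim_compose[OF real_powr_at_top filterlim_real_sequentially])
  then show ?thesis by (auto simp: filterlim_at_top_dense eventually_sequentially)
qed

section \<open>Boyd indices and power bounds\<close>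

text \<open>The definition of an Orlicz function asks only for weak monotonicity, so N could vanish
  near 0. Positivity on (0,1] excludes this; with convexity it makes N strictly increasing and
  \<open>orlicz_inv\<close> a true inverse on (0,1].\<close>

locale normalized_orlicz =
  fixes N :: "real \<Rightarrow> real"
  assumes orlicz: "orlicz_function N" and N_one: "N 1 = 1"
    and N_pos_unit: "\<And>s. 0 < s \<Longrightarrow> s \<le> 1 \<Longrightarrow> 0 < N s"
begin

lemma N_zero: "N 0 = 0"
  using orlicz by (simp add: orlicz_function_def)

lemma N_mono: "0 \<le> x \<Longrightarrow> x \<le> y \<Longrightarrow> N x \<le> N y"
  using orlicz by (auto simp: orlicz_function_def mono_on_def)

lemma N_nonneg: "0 \<le> x \<Longrightarrow> 0 \<le> N x"
  using N_mono[of 0 x] N_zero by simp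

lemma N_pos: "0 < x \<Longrightarrow> 0 < N x"
  using N_pos_unit[of x] N_mono[of 1 x] N_one by (cases "x \<le> 1") auto

text \<open>Convexity on the segment from 0, where N vanishes. This is the only form in which
  convexity is used.\<close>

lemma N_scale:
  assumes "0 \<le> c" "c \<le> 1" "0 \<le> x"
  shows "N (c * x) \<le> c * N x"
proof -
  have "convex_on {0..} N" using orlicz by (simp add: orlicz_function_def)
  from convex_onD[OF this, of c 0 x] show ?thesis using assms N_zero by simp
qed

lemma N_le_self: "0 \<le> x \<Longrightarrow> x \<le> 1 \<Longrightarrow> N x \<le> x"
  using N_scale[of x 1] N_one by simp

lemma N_strict_mono:
  assumes "0 \<le> x" "x < y"
  shows "N x < N y"
proof -
  have "N x \<le> (x / y) * N y" using N_scale[of "x / y" y] assms by simp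
  also have "\<dots> < 1 * N y" using assms N_pos[of y] by (intro mult_strict_right_mono) auto
  finally show ?thesis by simp
qed

lemma N_le_iff: "0 \<le> x \<Longrightarrow> 0 \<le> y \<Longrightarrow> N x \<le> N y \<longleftrightarrow> x \<le> y"
  using N_mono[of x y] N_strict_mono[of y x] by (cases "x \<le> y") auto

lemma N_less_iff: "0 \<le> x \<Longrightarrow> 0 \<le> y \<Longrightarrow> N x < N y \<longleftrightarrow> x < y"
  using N_le_iff[of y x] by (simp add: not_le[symmetric])

lemma orlicz_inv_props:
  assumes "0 < u" "u \<le> 1"
  shows "0 < orlicz_inv N u" "orlicz_inv N u \<le> 1" "N (orlicz_inv N u) = u"
proof -
  have "continuous_on {0..1} N"
    using orlicz by (auto simp: orlicz_function_def intro: continuous_on_subset)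
  then have "\<exists>t\<ge>0. t \<le> 1 \<and> N t = u"
    using assms N_zero N_one by (intro IVT') auto
  then obtain t where t: "0 \<le> t" "t \<le> 1" "N t = u" by blast
  have "orlicz_inv N u = t" unfolding orlicz_inv_def
  proof (rule the_equality)
    fix s assume "0 \<le> s \<and> N s = u"
    then show "s = t" using t N_less_iff[of s t] N_less_iff[of t s] by auto
  qed (use t in auto)
  moreover have "t \<noteq> 0" using t assms N_zero by auto
  ultimately show "0 < orlicz_inv N u" "orlicz_inv N u \<le> 1" "N (orlicz_inv N u) = u"
    using t by auto
qed

definition dyadic :: "nat \<Rightarrow> real" where
  "dyadic k = orlicz_inv N (2 powr (- real k))"

lemma dyadic_props: "0 < dyadic k" "dyadic k \<le> 1" "N (dyadic k) = 2 powr (- real k)"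
  unfolding dyadic_def by (intro orlicz_inv_props; simp add: powr_minus field_simps ge_one_powr_ge_zero)+

lemma two_powr_neg_add: "2 powr (- real (k + n)) = 2 powr (- real k) / (2 powr real n :: real)"
  by (simp add: powr_diff[symmetric])

text \<open>By convexity, halving the argument at least halves the value, so halving the value at
  most halves the argument. These are the step bounds that \<open>growth_index\<close>
  requires.\<close>

lemma dyadic_step: "dyadic (Suc k) \<le> dyadic k" "dyadic k / 2 \<le> dyadic (Suc k)"
proof -
  have eq: "2 powr (- real (Suc k)) = 2 powr (- real k) / 2"
    using two_powr_neg_add[of k 1] by simp
  have "N (dyadic (Suc k)) \<le> N (dyadic k)" by (simp add: dyadic_props eq)
  then show "dyadic (Suc k) \<le> dyadic k"
    using dyadic_props(1) by (simp add: N_le_iff less_imp_le)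
  have "N (dyadic k / 2) \<le> N (dyadic k) / 2"
    using N_scale[of "1 / 2" "dyadic k"] dyadic_props(1)[of k] by simp
  also have "\<dots> = N (dyadic (Suc k))" by (simp only: dyadic_props(3) eq)
  finally have "N (dyadic k / 2) \<le> N (dyadic (Suc k))" .
  then show "dyadic k / 2 \<le> dyadic (Suc k)"
    using dyadic_props(1) by (subst (asm) N_le_iff) (auto simp: less_imp_le)
qed

lemma inverse_dyadic_step:
  "1 / dyadic k \<le> 1 / dyadic (Suc k)" "1 / dyadic (Suc k) \<le> 2 * (1 / dyadic k)"
  using dyadic_step[of k] dyadic_props(1)[of k] dyadic_props(1)[of "Suc k"]
  by (simp_all add: field_simps)

lemma dyadic_antimono: "dyadic (k + n) \<le> dyadic k"
  by (induction n) (auto intro: order_trans[OF dyadic_step(1)])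

lemma dyadic_bracket:
  assumes "0 < s" "s \<le> 1"
  obtains k where "dyadic (Suc k) < s" "s \<le> dyadic k"
proof -
  have y: "0 < N s" "N s \<le> 1" using assms N_pos N_mono[of s 1] N_one by auto
  define k where "k = nat \<lfloor>- log 2 (N s)\<rfloor>"
  have "0 \<le> - log 2 (N s)" using y by simp
  then have k: "real k \<le> - log 2 (N s)" "- log 2 (N s) < real k + 1"
    unfolding k_def by (auto simp: of_nat_nat)
  have "N s \<le> 2 powr (- real k)" using k(1) y by (subst log_le_iff[symmetric]) auto
  moreover have "2 powr (- real (Suc k)) < N s" using k(2) y by (subst less_log_iff[symmetric]) auto
  ultimately have "N s \<le> N (dyadic k)" "N (dyadic (Suc k)) < N s" by (simp_all add: dyadic_props)
  then show ?thesis using that assms dyadic_props(1) by (simp add: N_le_iff N_less_iff less_imp_le)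
qed

text \<open>Up to the endpoint, \<open>upper_power q\<close> means \<open>q \<le> 1 / \<beta>\<close> and
  \<open>lower_power q\<close> means \<open>q \<ge> 1 / \<alpha>\<close>.\<close>

definition upper_power :: "real \<Rightarrow> bool" where
  "upper_power q \<longleftrightarrow> (\<exists>A>0. \<forall>s t. 0 < s \<longrightarrow> s \<le> 1 \<longrightarrow> 0 < t \<longrightarrow> t \<le> 1 \<longrightarrow> N (s * t) \<le> A * t powr q * N s)"

definition lower_power :: "real \<Rightarrow> bool" where
  "lower_power q \<longleftrightarrow> (\<exists>A>0. \<forall>s t. 0 < s \<longrightarrow> s \<le> 1 \<longrightarrow> 0 < t \<longrightarrow> t \<le> 1 \<longrightarrow> A * t powr q * N s \<le> N (s * t))"

text \<open>Enclose s and s t between consecutive dyadic points. The index distance n gives N(s t)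
  <= 4 * 2^(-n) N(s), a factor 2 for each of the two roundings, while the assumption says 2^(-l n)
  <= A t; its power 1/l converts one bound into the other.\<close>

lemma upper_power_if_dyadic:
  assumes l: "0 < l" and A: "0 < A"
    and bnd: "\<And>k n. dyadic k \<le> A * 2 powr (l * real n) * dyadic (k + n)"
  shows "upper_power (1 / l)"
  unfolding upper_power_def
proof (intro exI[of _ "4 * A powr (1 / l)"] conjI allI impI)
  show "0 < 4 * A powr (1 / l)" using A by simp
  fix s t :: real assume s: "0 < s" "s \<le> 1" and t: "0 < t" "t \<le> 1"
  have st: "0 < s * t" "s * t \<le> s" using s t by (auto intro: mult_left_le)
  obtain k where k: "dyadic (Suc k) < s" "s \<le> dyadic k" using dyadic_bracket s by blast
  obtain j where j: "dyadic (Suc j) < s * t" "s * t \<le> dyadic j" using dyadic_bracket[of "s * t"] st s by auto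
  have "k \<le> j"
  proof (rule ccontr)
    assume "\<not> k \<le> j"
    then have "dyadic k \<le> dyadic (Suc j)" using dyadic_antimono[of "Suc j" "k - Suc j"] by simp
    then show False using k j st by linarith
  qed
  define n where "n = Suc j - k"
  have kn: "k + n = Suc j" using \<open>k \<le> j\<close> by (simp add: n_def)
  have "s \<le> A * 2 powr (l * real n) * dyadic (k + n)" using k bnd[of k n] by linarith
  also have "\<dots> \<le> A * 2 powr (l * real n) * (s * t)" using kn j A by (intro mult_left_mono) auto
  finally have "1 \<le> A * 2 powr (l * real n) * t" using s by (simp add: field_simps)
  then have "2 powr (- l * real n) \<le> A * t" by (simp add: powr_minus field_simps)
  then have "(2 powr (- l * real n)) powr (1 / l) \<le> (A * t) powr (1 / l)"
    using l by (intro powr_mono2) auto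
  then have n: "2 powr (- real n) \<le> A powr (1 / l) * t powr (1 / l)"
    using l A t by (simp add: powr_powr powr_mult)
  have "N (s * t) \<le> N (dyadic j)" using j st by (intro N_mono) auto
  also have "\<dots> = 4 * 2 powr (- real n) * 2 powr (- real (Suc k))"
  proof -
    have "2 powr (- real j) = (2 powr 2) * 2 powr (- real n) * 2 powr (- real (Suc k))"
      using kn by (simp only: powr_add[symmetric]) (simp add: algebra_simps flip: of_nat_add)
    then show ?thesis by (simp add: dyadic_props)
  qed
  also have "\<dots> \<le> 4 * 2 powr (- real n) * N s"
    using k N_mono[of "dyadic (Suc k)" s] dyadic_props[of "Suc k"] by (intro mult_left_mono) auto
  also have "\<dots> \<le> 4 * (A powr (1 / l) * t powr (1 / l)) * N s"
    using n N_nonneg s by (intro mult_right_mono mult_left_mono) auto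
  finally show "N (s * t) \<le> 4 * A powr (1 / l) * t powr (1 / l) * N s" by (simp add: mult.assoc)
qed

lemma lower_power_if_dyadic:
  assumes l: "0 < l" and A: "0 < A"
    and bnd: "\<And>k n. dyadic (k + n) \<le> A * 2 powr (- l * real n) * dyadic k"
  shows "lower_power (1 / l)"
proof -
  \<comment> \<open>The value 1/2 serves the case j <= k, where N(s t) >= N(s)/2 without any use of
    \<open>bnd\<close>; the other value serves points at least one dyadic step apart.\<close>
  define B where "B = min (1 / 2) (1 / (4 * A powr (1 / l)))"
  have B: "0 < B" using A by (simp add: B_def)
  have "B * t powr (1 / l) * N s \<le> N (s * t)" if s: "0 < s" "s \<le> 1" and t: "0 < t" "t \<le> 1" for s t
  proof -
    have st: "0 < s * t" "s * t \<le> s" using s t by (auto intro: mult_left_le)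
    have Ns: "0 < N s" using N_pos s by simp
    obtain k where k: "dyadic (Suc k) < s" "s \<le> dyadic k" using dyadic_bracket s by blast
    obtain j where j: "dyadic (Suc j) < s * t" "s * t \<le> dyadic j" using dyadic_bracket[of "s * t"] st s by auto
    have Nst: "2 powr (- real (Suc j)) \<le> N (s * t)"
      using N_mono[of "dyadic (Suc j)" "s * t"] j dyadic_props[of "Suc j"] by auto
    have Nsk: "N s \<le> 2 powr (- real k)"
      using N_mono[of s "dyadic k"] k s dyadic_props[of k] by auto
    show ?thesis
    proof (cases "j \<le> k")
      case True
      have "B * t powr (1 / l) * N s \<le> (1 / 2) * 1 * N s"
        using l t Ns B by (intro mult_right_mono mult_mono) (auto simp: B_def powr_le1)
      also have "\<dots> \<le> 2 powr (- 1) * 2 powr (- real k)" using Nsk by (simp add: powr_minus)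
      also have "\<dots> \<le> 2 powr (- real (Suc j))"
        using True by (simp only: powr_add[symmetric]) simp
      finally show ?thesis using Nst by simp
    next
      case False
      \<comment> \<open>Rounded inwards, opposite to the upper estimate:
        \<open>dyadic (Suc k)\<close> lies below s and \<open>dyadic j\<close> above s t, so
        \<open>bnd\<close> gives an upper bound for t. Here j > k, so the subtraction is not
        truncated.\<close>
      define n where "n = j - Suc k"
      have kn: "Suc k + n = j" using False by (simp add: n_def)
      have "s * t \<le> A * 2 powr (- l * real n) * dyadic (Suc k)" using j bnd[of "Suc k" n] kn by simp
      also have "\<dots> \<le> A * 2 powr (- l * real n) * s" using k A by (intro mult_left_mono) auto
      finally have "t / A \<le> 2 powr (- l * real n)" using s A by (simp add: field_simps)
      then have "(t / A) powr (1 / l) \<le> (2 powr (- l * real n)) powr (1 / l)"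
        using l t A by (intro powr_mono2) auto
      then have n: "t powr (1 / l) / A powr (1 / l) \<le> 2 powr (- real n)"
        using l A t by (simp add: powr_powr powr_divide)
      have "B * t powr (1 / l) * N s \<le> 1 / (4 * A powr (1 / l)) * t powr (1 / l) * N s"
        using Ns by (intro mult_right_mono) (auto simp: B_def)
      also have "\<dots> = (1 / 4) * (t powr (1 / l) / A powr (1 / l)) * N s" by simp
      also have "\<dots> \<le> (1 / 4) * 2 powr (- real n) * 2 powr (- real k)"
        using n Nsk Ns by (intro mult_mono) auto
      also have "\<dots> = 2 powr (- 2) * 2 powr (- real n) * 2 powr (- real k)" by (simp add: powr_minus)
      also have "\<dots> = 2 powr (- real (Suc j))"
        unfolding kn[symmetric] by (simp only: powr_add[symmetric]) (simp add: algebra_simps)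
      finally show ?thesis using Nst by simp
    qed
  qed
  then show ?thesis unfolding lower_power_def using B by blast
qed

text \<open>At s = \<open>dyadic k\<close> and t = \<open>dyadic (k + n) / dyadic k\<close> the
  estimate reads 2^(-n) <= A t^q; the power 1/q gives the claim.\<close>

lemma dyadic_if_upper_power:
  assumes q: "0 < q" and up: "upper_power q"
  obtains A where "0 < A" "\<And>k n. dyadic k \<le> A * 2 powr ((1 / q) * real n) * dyadic (k + n)"
proof -
  obtain A where A: "0 < A" and *: "\<And>s t. 0 < s \<Longrightarrow> s \<le> 1 \<Longrightarrow> 0 < t \<Longrightarrow> t \<le> 1 \<Longrightarrow> N (s * t) \<le> A * t powr q * N s"
    using up unfolding upper_power_def by blast
  have "dyadic k \<le> A powr (1 / q) * 2 powr ((1 / q) * real n) * dyadic (k + n)" for k n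
  proof -
    define t where "t = dyadic (k + n) / dyadic k"
    have t: "0 < t" "t \<le> 1" "dyadic k * t = dyadic (k + n)"
      using dyadic_props(1)[of k] dyadic_props(1)[of "k + n"] dyadic_antimono[of k n] by (auto simp: t_def)
    have "2 powr (- real (k + n)) \<le> A * t powr q * 2 powr (- real k)"
      using *[of "dyadic k" t] t dyadic_props by simp
    then have "1 \<le> A * t powr q * 2 powr real n" unfolding two_powr_neg_add by (simp add: powr_minus field_simps)
    then have "1 powr (1 / q) \<le> (A * t powr q * 2 powr real n) powr (1 / q)"
      using q by (intro powr_mono2) auto
    then have "1 \<le> A powr (1 / q) * 2 powr ((1 / q) * real n) * t"
      using q A t by (simp add: powr_mult powr_powr mult_ac)
    then have "dyadic k * 1 \<le> dyadic k * (A powr (1 / q) * 2 powr ((1 / q) * real n) * t)"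
      using dyadic_props(1)[of k] by (intro mult_left_mono) auto
    then show ?thesis unfolding t(3)[symmetric] by (simp add: mult_ac)
  qed
  then show ?thesis using that[of "A powr (1 / q)"] A by auto
qed

lemma dyadic_if_lower_power:
  assumes q: "0 < q" and low: "lower_power q"
  obtains A where "0 < A" "\<And>k n. dyadic (k + n) \<le> A * 2 powr (- (1 / q) * real n) * dyadic k"
proof -
  obtain A where A: "0 < A" and *: "\<And>s t. 0 < s \<Longrightarrow> s \<le> 1 \<Longrightarrow> 0 < t \<Longrightarrow> t \<le> 1 \<Longrightarrow> A * t powr q * N s \<le> N (s * t)"
    using low unfolding lower_power_def by blast
  have "dyadic (k + n) \<le> (1 / A) powr (1 / q) * 2 powr (- (1 / q) * real n) * dyadic k" for k n
  proof -
    define t where "t = dyadic (k + n) / dyadic k"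
    have t: "0 < t" "t \<le> 1" "dyadic k * t = dyadic (k + n)"
      using dyadic_props(1)[of k] dyadic_props(1)[of "k + n"] dyadic_antimono[of k n] by (auto simp: t_def)
    have "A * t powr q * 2 powr (- real k) \<le> 2 powr (- real (k + n))"
      using *[of "dyadic k" t] t dyadic_props by simp
    then have "t powr q \<le> (1 / A) * 2 powr (- real n)" using A unfolding two_powr_neg_add by (simp add: powr_minus field_simps)
    then have "(t powr q) powr (1 / q) \<le> ((1 / A) * 2 powr (- real n)) powr (1 / q)"
      using q by (intro powr_mono2) auto
    then have "t \<le> (1 / A) powr (1 / q) * 2 powr (- (1 / q) * real n)"
      using q A t by (simp add: powr_mult powr_powr mult_ac powr_divide)
    then have "dyadic k * t \<le> dyadic k * ((1 / A) powr (1 / q) * 2 powr (- (1 / q) * real n))"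
      using dyadic_props(1)[of k] by (intro mult_left_mono) auto
    then show ?thesis unfolding t(3)[symmetric] by (simp add: mult_ac)
  qed
  then show ?thesis using that[of "(1 / A) powr (1 / q)"] A by auto
qed

lemma boyd_alpha_eq:
  "boyd_alpha N = - lim (\<lambda>n. (1 / real n) * log 2 (SUP k. dyadic (k + n) / dyadic k))"
  by (simp add: boyd_alpha_def dyadic_def)

text \<open>Shifting k by n turns the supremum over k >= n into one over all k, so that beta becomes
  the growth index of the increasing sequence \<open>1 / dyadic\<close>.\<close>

lemma boyd_beta_eq:
  "boyd_beta N = lim (\<lambda>n. (1 / real n) * log 2 (SUP k. (1 / dyadic (k + n)) / (1 / dyadic k)))"
proof -
  have "(SUP k\<in>{n..}. orlicz_inv N (2 powr (- real k + real n)) / orlicz_inv N (2 powr (- real k)))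
      = (SUP k. (1 / dyadic (k + n)) / (1 / dyadic k))" for n
  proof -
    have "{n..} = range (\<lambda>k. k + n)"
      by (auto simp: image_def intro: exI[of _ "_ - n"]) presburger
    then show ?thesis by (simp add: image_image dyadic_def)
  qed
  then show ?thesis by (simp add: boyd_beta_def)
qed

lemma lower_power_if_alpha:
  assumes q: "0 < q" and a: "1 / q < boyd_alpha N"
  shows "lower_power q"
proof -
  have "\<exists>A>0. \<forall>k n. dyadic (k + n) \<le> A * 2 powr (- (1 / q) * real n) * dyadic k"
    using a dyadic_props(1) dyadic_step
    by (intro growth_index(1)[where b = "1/2" and B = 1]) (auto simp: boyd_alpha_eq)
  then show ?thesis using lower_power_if_dyadic[of "1 / q"] q by auto
qed

lemma alpha_ge_if_lower_power:
  assumes q: "0 < q" and low: "lower_power q"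
  shows "1 / q \<le> boyd_alpha N"
proof -
  obtain A where A: "0 < A" "\<And>k n. dyadic (k + n) \<le> A * 2 powr (- (1 / q) * real n) * dyadic k"
    using dyadic_if_lower_power[OF q low] by blast
  have "- boyd_alpha N \<le> - (1 / q)" unfolding boyd_alpha_eq minus_minus
    using A dyadic_props(1) dyadic_step
    by (intro growth_index(2)[where b = "1/2" and B = 1 and A = A]) auto
  then show ?thesis by simp
qed

lemma upper_power_if_beta:
  assumes q: "0 < q" and b: "boyd_beta N < 1 / q"
  shows "upper_power q"
proof -
  have "\<exists>A>0. \<forall>k n. 1 / dyadic (k + n) \<le> A * 2 powr ((1 / q) * real n) * (1 / dyadic k)"
    using b[unfolded boyd_beta_eq] dyadic_props(1) inverse_dyadic_step
    by (intro growth_index(1)[where b = 1 and B = 2]) auto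
  then show ?thesis using upper_power_if_dyadic[of "1 / q"] q dyadic_props(1)
    by (auto simp: field_simps)
qed

lemma beta_le_if_upper_power:
  assumes q: "0 < q" and up: "upper_power q"
  shows "boyd_beta N \<le> 1 / q"
proof -
  obtain A where A: "0 < A" "\<And>k n. dyadic k \<le> A * 2 powr ((1 / q) * real n) * dyadic (k + n)"
    using dyadic_if_upper_power[OF q up] by blast
  have *: "\<forall>k n. 1 / dyadic (k + n) \<le> A * 2 powr ((1 / q) * real n) * (1 / dyadic k)"
  proof (intro allI)
    fix k n
    show "1 / dyadic (k + n) \<le> A * 2 powr ((1 / q) * real n) * (1 / dyadic k)"
      using A(2)[of k n] dyadic_props(1)[of k] dyadic_props(1)[of "k + n"] by (simp add: field_simps)
  qed
  show ?thesis unfolding boyd_beta_eq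
    using A(1) * dyadic_props(1) inverse_dyadic_step
    by (intro growth_index(2)[where b = 1 and B = 2 and A = A]) auto
qed

end

section \<open>Approximating powers by sums of dilates\<close>

context normalized_orlicz
begin

text \<open>Monotonicity fills the gaps between powers of rho. Rounding s and t costs at most two
  powers of rho in t, hence the constant with (rho^2)^q.\<close>

lemma upper_power_if_geometric:
  assumes \<rho>: "0 < \<rho>" "\<rho> < 1" and q: "0 \<le> q" and A: "0 < A"
    and bnd: "\<And>i n. N (\<rho> ^ (i + n)) \<le> A * (\<rho> ^ n) powr q * N (\<rho> ^ i)"
  shows "upper_power q"
  unfolding upper_power_def
proof (intro exI[of _ "(A + 1) / (\<rho> ^ 2) powr q"] conjI allI impI)
  show "0 < (A + 1) / (\<rho> ^ 2) powr q" using A \<rho> by simp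
  fix s t :: real assume s: "0 < s" "s \<le> 1" and t: "0 < t" "t \<le> 1"
  have st: "0 < s * t" "s * t \<le> s" using s t by (auto intro: mult_left_le)
  have Ns: "0 < N s" using N_pos s by simp
  obtain i where i: "\<rho> ^ Suc i < s" "s \<le> \<rho> ^ i" using power_bracket \<rho> s by blast
  obtain m where m: "\<rho> ^ Suc m < t" "t \<le> \<rho> ^ m" using power_bracket \<rho> t by blast
  show "N (s * t) \<le> (A + 1) / (\<rho> ^ 2) powr q * t powr q * N s"
  proof (cases m)
    case 0
    \<comment> \<open>Here rho < t, so no power of rho is left after rounding; monotonicity alone
      suffices, paid for by the 1 in A + 1.\<close>
    have "\<rho> ^ 2 \<le> \<rho> ^ 1" using \<rho> by (intro power_decreasing) auto
    then have "(\<rho> ^ 2) powr q \<le> t powr q" using m 0 q \<rho> by (intro powr_mono2) auto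
    then have "1 \<le> 1 / (\<rho> ^ 2) powr q * t powr q" using \<rho> by simp
    also have "\<dots> \<le> (A + 1) / (\<rho> ^ 2) powr q * t powr q" using A
      by (intro mult_right_mono divide_right_mono) auto
    finally have "1 * N s \<le> (A + 1) / (\<rho> ^ 2) powr q * t powr q * N s" using Ns
      by (intro mult_right_mono) auto
    then show ?thesis using N_mono[of "s * t" s] st by simp
  next
    case (Suc k)
    have "s * t \<le> \<rho> ^ i * \<rho> ^ m" using i m s t \<rho> by (intro mult_mono) auto
    then have "N (s * t) \<le> N (\<rho> ^ (Suc i + k))" using st Suc
      by (intro N_mono) (auto simp: power_add algebra_simps)
    also have "\<dots> \<le> A * (\<rho> ^ k) powr q * N (\<rho> ^ Suc i)" by (rule bnd)
    also have "\<dots> \<le> A * (\<rho> ^ k) powr q * N s" using i A \<rho> by (intro mult_left_mono N_mono) auto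
    also have "\<dots> \<le> (A + 1) * (t powr q / (\<rho> ^ 2) powr q) * N s"
    proof -
      have "\<rho> ^ k * \<rho> ^ 2 = \<rho> ^ Suc m" using Suc by (simp add: power2_eq_square algebra_simps)
      then have "(\<rho> ^ k * \<rho> ^ 2) powr q \<le> t powr q" using m q \<rho> by (intro powr_mono2) auto
      then have "(\<rho> ^ k) powr q \<le> t powr q / (\<rho> ^ 2) powr q" using \<rho> by (simp add: powr_mult field_simps)
      then show ?thesis using A Ns by (intro mult_right_mono mult_mono) auto
    qed
    finally show ?thesis by simp
  qed
qed

lemma lower_power_if_geometric:
  assumes \<rho>: "0 < \<rho>" "\<rho> < 1" and q: "0 \<le> q" and A: "0 < A"
    and bnd: "\<And>i n. A * (\<rho> ^ n) powr q * N (\<rho> ^ i) \<le> N (\<rho> ^ (i + n))"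
  shows "lower_power q"
  unfolding lower_power_def
proof (intro exI[of _ "A * (\<rho> ^ 2) powr q"] conjI allI impI)
  show "0 < A * (\<rho> ^ 2) powr q" using A \<rho> by simp
  fix s t :: real assume s: "0 < s" "s \<le> 1" and t: "0 < t" "t \<le> 1"
  obtain i where i: "\<rho> ^ Suc i < s" "s \<le> \<rho> ^ i" using power_bracket \<rho> s by blast
  obtain m where m: "\<rho> ^ Suc m < t" "t \<le> \<rho> ^ m" using power_bracket \<rho> t by blast
  have "A * (\<rho> ^ 2) powr q * t powr q * N s \<le> A * (\<rho> ^ 2) powr q * (\<rho> ^ m) powr q * N (\<rho> ^ i)"
    using A s t i m q by (intro mult_mono N_mono powr_mono2) (auto simp: N_nonneg)
  also have "\<dots> = A * (\<rho> ^ (m + 2)) powr q * N (\<rho> ^ i)"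
    using \<rho> by (simp add: powr_mult power_add power2_eq_square algebra_simps)
  also have "\<dots> \<le> N (\<rho> ^ (i + (m + 2)))" by (rule bnd)
  also have "\<dots> \<le> N (s * t)"
  proof (rule N_mono)
    have "\<rho> ^ Suc i * \<rho> ^ Suc m \<le> s * t" using i m \<rho> s by (intro mult_mono) auto
    then show "\<rho> ^ (i + (m + 2)) \<le> s * t" by (simp add: power_add power2_eq_square algebra_simps)
  qed (use \<rho> in simp)
  finally show "A * (\<rho> ^ 2) powr q * t powr q * N s \<le> N (s * t)" .
qed

text \<open>\<open>G\<close> is constant for N(t) = t^p and measures the deviation from that power.
  Both \<open>L\<close> and \<open>a0\<close> stay free: the former is later chosen to control
  shifts of the interval, the latter to control rounding.\<close>

lemma dominating_interval_sum:
  assumes \<rho>: "0 < \<rho>" "\<rho> < 1" and p: "0 < p" and L: "1 < L"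
    and no_upper: "\<And>q. p < q \<Longrightarrow> \<not> upper_power q"
    and no_lower: "\<And>q. 0 < q \<Longrightarrow> q < p \<Longrightarrow> \<not> lower_power q"
  defines "G \<equiv> \<lambda>j. N (\<rho> ^ j) / (\<rho> ^ j) powr p"
  obtains a b where "a0 \<le> a" "a < b" "L * (G a + G b) < (\<Sum>j=a..<b. G j)"
proof (rule ccontr)
  assume "\<not> thesis"
  then have dom: "\<And>a b. a0 \<le> a \<Longrightarrow> a < b \<Longrightarrow> (\<Sum>j=a..<b. G j) \<le> L * (G a + G b)"
    using that by force
  have pos: "0 < G j" for j unfolding G_def using N_pos \<rho> by simp
  have split: "(\<rho> ^ (i + n)) powr p = (\<rho> ^ i) powr p * (\<rho> ^ n) powr p" for i n
    using \<rho> by (simp add: power_add powr_mult)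
  show False
  proof (rule doubly_dominated_sums_dichotomy[of G L a0, OF pos L dom])
    fix b0 :: nat and A \<theta> :: real
    assume A: "0 < A" and \<theta>: "0 < \<theta>" "\<theta> < 1"
      and G: "\<And>i j. b0 \<le> i \<Longrightarrow> i \<le> j \<Longrightarrow> G j \<le> A * \<theta> ^ (j - i) * G i"
    have "\<exists>A>0. \<forall>i n. b0 \<le> i \<longrightarrow> G (i + n) \<le> A * \<theta> ^ n * G i"
    proof (intro exI[of _ A] conjI allI impI A)
      fix i n assume "b0 \<le> i"
      then show "G (i + n) \<le> A * \<theta> ^ n * G i" using G[of i "i + n"] by simp
    qed
    from eventual_geometric_bound_global[OF pos \<theta>(1) this]
    obtain B where B: "0 < B" "\<And>i n. G (i + n) \<le> B * \<theta> ^ n * G i" by blast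
    \<comment> \<open>Now \<open>\<theta>\<close>^n = (rho^n)^e, so a geometric rate of
      \<open>G\<close> shifts the exponent p by e, which is positive because both numbers lie in
      (0,1).\<close>
    define e where "e = log \<rho> \<theta>"
    have e: "0 < e" using \<rho> \<theta> by (simp add: e_def log_def zero_less_divide_iff)
    have "upper_power (p + e)"
    proof (rule upper_power_if_geometric[OF \<rho> _ B(1)])
      fix i n
      have "N (\<rho> ^ (i + n)) = G (i + n) * (\<rho> ^ (i + n)) powr p" using \<rho> by (simp add: G_def)
      also have "\<dots> \<le> (B * (\<rho> ^ n) powr e * G i) * (\<rho> ^ (i + n)) powr p"
        using B(2)[of i n] power_eq_powr_log[OF \<rho> \<theta>(1), of n] by (intro mult_right_mono) (auto simp: e_def)
      also have "\<dots> = B * (\<rho> ^ n) powr (p + e) * N (\<rho> ^ i)"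
        unfolding split using \<rho> by (simp add: G_def powr_add)
      finally show "N (\<rho> ^ (i + n)) \<le> B * (\<rho> ^ n) powr (p + e) * N (\<rho> ^ i)" .
    qed (use p e in simp)
    then show False using no_upper[of "p + e"] e by simp
  next
    fix b0 :: nat and A \<theta> :: real
    assume A: "0 < A" and \<theta>: "0 < \<theta>" "\<theta> < 1"
      and G: "\<And>i j. b0 \<le> i \<Longrightarrow> i \<le> j \<Longrightarrow> G i \<le> A * \<theta> ^ (j - i) * G j"
    have "\<exists>A>0. \<forall>i n. b0 \<le> i \<longrightarrow> 1 / G (i + n) \<le> A * \<theta> ^ n * (1 / G i)"
    proof (intro exI[of _ A] conjI allI impI A)
      fix i n assume "b0 \<le> i"
      then show "1 / G (i + n) \<le> A * \<theta> ^ n * (1 / G i)"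
        using G[of i "i + n"] pos[of i] pos[of "i + n"] by (simp add: field_simps)
    qed
    from eventual_geometric_bound_global[OF _ \<theta>(1) this] pos
    obtain B where B: "0 < B" "\<And>i n. 1 / G (i + n) \<le> B * \<theta> ^ n * (1 / G i)" by auto
    define e where "e = log \<rho> \<theta>"
    have e: "0 < e" using \<rho> \<theta> by (simp add: e_def log_def zero_less_divide_iff)
    \<comment> \<open>The exponent p - e may fail to be positive, and \<open>no_lower\<close> speaks
      of positive exponents only. Since t <= 1, a lower estimate survives an increase of the
      exponent.\<close>
    define q where "q = max (p - e) (p / 2)"
    have q: "0 < q" "q < p" "p - e \<le> q" using e p by (auto simp: q_def)
    have "lower_power q"
    proof (rule lower_power_if_geometric[OF \<rho>])
      show "0 < 1 / B" using B by simp
      fix i n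
      have "1 / B * (\<rho> ^ n) powr q * N (\<rho> ^ i) \<le> 1 / B * (\<rho> ^ n) powr (p - e) * N (\<rho> ^ i)"
        using \<rho> B q N_nonneg by (intro mult_right_mono mult_left_mono powr_mono') (auto simp: power_le_one)
      also have "\<dots> = (1 / (B * (\<rho> ^ n) powr e)) * G i * (\<rho> ^ (i + n)) powr p"
        unfolding split using \<rho> by (simp add: G_def powr_diff)
      also have "\<dots> \<le> G (i + n) * (\<rho> ^ (i + n)) powr p"
      proof (rule mult_right_mono)
        have "1 / G (i + n) \<le> B * (\<rho> ^ n) powr e * (1 / G i)"
          using B(2)[of i n] power_eq_powr_log[OF \<rho> \<theta>(1), of n] by (simp add: e_def)
        then show "(1 / (B * (\<rho> ^ n) powr e)) * G i \<le> G (i + n)"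
          using pos[of i] pos[of "i + n"] B \<rho> by (simp add: field_simps)
      qed simp
      also have "\<dots> = N (\<rho> ^ (i + n))" using \<rho> by (simp add: G_def)
      finally show "1 / B * (\<rho> ^ n) powr q * N (\<rho> ^ i) \<le> N (\<rho> ^ (i + n))" .
    qed (use q in simp)
    then show False using no_lower q by simp
  qed
qed

text \<open>With exact weights 1/(w^j A) instead of integer multiplicities, the sum at t = rho^h is
  w^h = t^p times the ratio of the sums of \<open>G\<close> over the shifted and the original
  interval. Between grid points both sides are monotone, so control on the grid suffices. The
  entries of \<open>xs\<close> become the coordinates of one block.\<close>

lemma power_approximation:
  assumes p: "1 \<le> p" and \<eta>: "0 < \<eta>"
    and no_upper: "\<And>q. p < q \<Longrightarrow> \<not> upper_power q"
    and no_lower: "\<And>q. 0 < q \<Longrightarrow> q < p \<Longrightarrow> \<not> lower_power q"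
  obtains xs where "\<And>x. x \<in> set xs \<Longrightarrow> 0 < x"
    "\<And>t. 0 \<le> t \<Longrightarrow> t \<le> 1 \<Longrightarrow> \<bar>(\<Sum>x\<leftarrow>xs. N (t * x)) - t powr p\<bar> \<le> \<eta>"
proof -
  \<comment> \<open>Three errors of this size occur: shift of the interval, rounding, and either the
    mesh of the grid or the size of t^p below the grid.\<close>
  define \<delta> where "\<delta> = min \<eta> 1 / 3"
  have \<delta>: "0 < \<delta>" "\<delta> < 1" "3 * \<delta> \<le> \<eta>" using \<eta> by (auto simp: \<delta>_def)
  define w where "w = 1 - \<delta>"
  have w: "0 < w" "w < 1" using \<delta> by (auto simp: w_def)
  \<comment> \<open>Chosen so that t^p shrinks by the factor w = 1 - \<open>\<delta>\<close> from
    one grid point to the next.\<close>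
  define \<rho> where "\<rho> = w powr (1 / p)"
  have \<rho>0: "0 < \<rho>" using w by (simp add: \<rho>_def)
  have \<rho>p: "\<rho> powr p = w" using p w by (simp add: \<rho>_def powr_powr)
  have \<rho>1: "\<rho> < 1"
  proof (rule ccontr)
    assume "\<not> \<rho> < 1"
    then have "1 powr p \<le> \<rho> powr p" using p by (intro powr_mono2) auto
    then show False using \<rho>p w by simp
  qed
  have \<rho>w: "(\<rho> ^ j) powr p = w ^ j" for j
    using \<rho>0 \<rho>p by (simp add: powr_realpow[symmetric] powr_powr mult.commute) (simp add: powr_powr[symmetric] \<rho>p powr_realpow w)
  obtain H where H: "w ^ H < \<delta>" using real_arch_pow_inv[OF \<delta>(1) w(2)] by blast
  \<comment> \<open>Beyond \<open>a0\<close> the powers of rho sum to less than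
    \<open>\<delta>\<close>, which bounds the total loss by rounding.\<close>
  obtain a0 where a0: "\<rho> ^ a0 < \<delta> * (1 - \<rho>)"
    using real_arch_pow_inv[OF _ \<rho>1, of "\<delta> * (1 - \<rho>)"] \<delta> \<rho>1 by auto
  \<comment> \<open>At most \<open>H\<close> terms following an end point sum to at most H/w^H times
    the term there (\<open>edge\<close>). With this L both edges together cost at most
    \<open>\<delta>\<close> times the full sum; the summand 2 ensures L > 1.\<close>
  define L where "L = real H / (w ^ H * \<delta>) + 2"
  have L1: "1 < L" and LH: "real H / w ^ H \<le> L * \<delta>"
    using w \<delta> by (auto simp: L_def field_simps add_nonneg_pos)
  define G where "G j = N (\<rho> ^ j) / w ^ j" for j
  have p0: "0 < p" using p by simp
  obtain a b where ab: "a0 \<le> a" "a < b" "L * (G a + G b) < (\<Sum>j=a..<b. G j)"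
    unfolding G_def \<rho>w[symmetric]
    by (rule dominating_interval_sum[OF \<rho>0 \<rho>1 p0 L1 no_upper no_lower, of a0])
  define A where "A = (\<Sum>j=a..<b. G j)"
  have G_pos: "0 < G j" for j using N_pos \<rho>0 w by (simp add: G_def)
  have A: "0 < A" unfolding A_def using ab G_pos by (intro sum_pos) auto
  define d where "d j = nat \<lfloor>1 / (w ^ j * A)\<rfloor>" for j
  have d: "real (d j) \<le> 1 / (w ^ j * A)" "1 / (w ^ j * A) - real (d j) \<le> 1" for j
  proof -
    have "0 \<le> 1 / (w ^ j * A)" using w A by simp
    then have "real (d j) = of_int \<lfloor>1 / (w ^ j * A)\<rfloor>" unfolding d_def by (simp add: of_nat_nat)
    then show "real (d j) \<le> 1 / (w ^ j * A)" "1 / (w ^ j * A) - real (d j) \<le> 1" by linarith+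
  qed
  define F where "F t = (\<Sum>j=a..<b. real (d j) * N (t * \<rho> ^ j))" for t
  have F_mono: "F s \<le> F t" if "0 \<le> s" "s \<le> t" for s t
    unfolding F_def using that \<rho>0 by (intro sum_mono mult_left_mono N_mono mult_right_mono) auto
  have F_nonneg: "0 \<le> F t" if "0 \<le> t" for t
    unfolding F_def using that \<rho>0 N_nonneg by (intro sum_nonneg mult_nonneg_nonneg) auto
  have edge: "(\<Sum>j=c..<c+h. G j) \<le> real H / w ^ H * G c" if h: "h \<le> H" for c h
  proof -
    have "G j \<le> G c / w ^ H" if j: "j \<in> {c..<c+h}" for j
    proof -
      have "N (\<rho> ^ j) \<le> N (\<rho> ^ c)" using j \<rho>0 \<rho>1 by (intro N_mono power_decreasing) auto
      moreover have "w ^ (c + H) \<le> w ^ j" using j h w by (intro power_decreasing) auto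
      ultimately have "N (\<rho> ^ j) / w ^ j \<le> N (\<rho> ^ c) / w ^ (c + H)"
        using w \<rho>0 by (intro frac_le N_nonneg) auto
      then show ?thesis by (simp add: G_def power_add)
    qed
    then have "(\<Sum>j=c..<c+h. G j) \<le> of_nat (card {c..<c+h}) * (G c / w ^ H)"
      by (intro sum_bounded_above) auto
    also have "\<dots> \<le> real H * (G c / w ^ H)" using h G_pos[of c] w by (intro mult_right_mono) auto
    finally show ?thesis by simp
  qed
  have grid: "\<bar>F (\<rho> ^ h) - w ^ h\<bar> \<le> 2 * \<delta>" if h: "h \<le> H" for h
  proof -
    \<comment> \<open>\<open>F\<close> at the grid point before rounding the weights.\<close>
    define E where "E = (\<Sum>j=a..<b. 1 / (w ^ j * A) * N (\<rho> ^ h * \<rho> ^ j))"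
    have "E = (\<Sum>j=a..<b. w ^ h / A * G (j + h))"
      unfolding E_def using w by (intro sum.cong) (auto simp: G_def power_add field_simps)
    also have "\<dots> = w ^ h / A * (\<Sum>j=a+h..<b+h. G j)"
      by (simp add: sum_distrib_left sum.shift_bounds_nat_ivl)
    finally have E: "E = w ^ h / A * (\<Sum>j=a+h..<b+h. G j)" .
    \<comment> \<open>Both sides sum over [a, b+h), so the shift by h costs only the two edges, even
      when h exceeds b - a.\<close>
    have "(\<Sum>j=a..<b. G j) + (\<Sum>j=b..<b+h. G j) = (\<Sum>j=a..<a+h. G j) + (\<Sum>j=a+h..<b+h. G j)"
      using ab by (simp add: sum.atLeastLessThan_concat)
    moreover have "0 \<le> (\<Sum>j=c..<c+h. G j)" for c using G_pos by (intro sum_nonneg) (auto simp: less_imp_le)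
    ultimately have "\<bar>(\<Sum>j=a+h..<b+h. G j) - A\<bar> \<le> (\<Sum>j=a..<a+h. G j) + (\<Sum>j=b..<b+h. G j)"
      unfolding A_def by (smt (verit))
    also have "\<dots> \<le> real H / w ^ H * G a + real H / w ^ H * G b" using edge h by (intro add_mono) auto
    also have "\<dots> = real H / w ^ H * (G a + G b)" by (simp add: distrib_left)
    also have "\<dots> \<le> L * \<delta> * (G a + G b)" using LH G_pos[of a] G_pos[of b] by (intro mult_right_mono) auto
    also have "\<dots> = \<delta> * (L * (G a + G b))" by simp
    also have "\<dots> \<le> \<delta> * A" using ab \<delta> unfolding A_def by (intro mult_left_mono) auto
    finally have *: "\<bar>(\<Sum>j=a+h..<b+h. G j) - A\<bar> \<le> \<delta> * A" .
    have "E - w ^ h = w ^ h / A * ((\<Sum>j=a+h..<b+h. G j) - A)" using A by (simp add: E right_diff_distrib)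
    then have "\<bar>E - w ^ h\<bar> = w ^ h / A * \<bar>(\<Sum>j=a+h..<b+h. G j) - A\<bar>" using A w by (simp add: abs_mult)
    also have "\<dots> \<le> 1 / A * (\<delta> * A)"
      using * A w \<delta> by (intro mult_mono divide_right_mono) (auto simp: power_le_one)
    finally have E_err: "\<bar>E - w ^ h\<bar> \<le> \<delta>" using A by simp
    have "E - F (\<rho> ^ h) = (\<Sum>j=a..<b. (1 / (w ^ j * A) - real (d j)) * N (\<rho> ^ h * \<rho> ^ j))"
      unfolding E_def F_def by (simp only: sum_subtractf[symmetric] left_diff_distrib)
    also have "\<dots> \<le> (\<Sum>j=a..<b. 1 * \<rho> ^ j)"
    proof (intro sum_mono mult_mono)
      fix j
      have le: "\<rho> ^ h * \<rho> ^ j \<le> \<rho> ^ j" using \<rho>0 \<rho>1 by (simp add: power_le_one mult_left_le_one_le)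
      also have "\<dots> \<le> 1" using \<rho>0 \<rho>1 by (simp add: power_le_one)
      finally have "N (\<rho> ^ h * \<rho> ^ j) \<le> \<rho> ^ h * \<rho> ^ j" using \<rho>0 by (intro N_le_self) auto
      then show "N (\<rho> ^ h * \<rho> ^ j) \<le> \<rho> ^ j" using le by (rule order_trans)
    qed (use d \<rho>0 N_nonneg in auto)
    also have "\<dots> \<le> \<rho> ^ a / (1 - \<rho>)" using sum_geometric_tail_le[OF \<rho>0 \<rho>1] by simp
    also have "\<dots> \<le> \<rho> ^ a0 / (1 - \<rho>)" using ab \<rho>0 \<rho>1 by (intro divide_right_mono power_decreasing) auto
    also have "\<dots> \<le> \<delta>" using a0 \<rho>1 by (simp add: field_simps)
    finally have "E - F (\<rho> ^ h) \<le> \<delta>" .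
    moreover have "F (\<rho> ^ h) \<le> E" unfolding E_def F_def
      using d \<rho>0 N_nonneg by (intro sum_mono mult_right_mono) auto
    ultimately show ?thesis using E_err by linarith
  qed
  have approx: "\<bar>F t - t powr p\<bar> \<le> \<eta>" if t: "0 \<le> t" "t \<le> 1" for t
  proof (cases "t = 0")
    case True
    then show ?thesis using \<eta> by (simp add: F_def N_zero)
  next
    case False
    then have t0: "0 < t" using t by simp
    obtain h where h: "\<rho> ^ Suc h < t" "t \<le> \<rho> ^ h" using power_bracket[OF \<rho>0 \<rho>1 t0 t(2)] by blast
    show ?thesis
    proof (cases "h < H")
      case True
      have "w ^ Suc h \<le> t powr p" "t powr p \<le> w ^ h"
        using h p t \<rho>0 unfolding \<rho>w[symmetric] by (intro powr_mono2; simp)+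
      moreover have "F (\<rho> ^ Suc h) \<le> F t" "F t \<le> F (\<rho> ^ h)"
        using h t \<rho>0 by (intro F_mono; simp)+
      moreover have "w ^ h - w ^ Suc h \<le> \<delta>"
      proof -
        have "w ^ h - w ^ Suc h = \<delta> * w ^ h" by (simp add: w_def algebra_simps)
        also have "\<dots> \<le> \<delta> * 1" using w \<delta> by (intro mult_left_mono) (auto simp: power_le_one)
        finally show ?thesis by simp
      qed
      ultimately show ?thesis using grid[of h] grid[of "Suc h"] True \<delta>(3) by linarith
    next
      case False
      \<comment> \<open>Below the grid both \<open>F t\<close> and t^p are nonnegative and at most
        their values at rho^H, which are small.\<close>
      have "\<rho> ^ h \<le> \<rho> ^ H" using False \<rho>0 \<rho>1 by (intro power_decreasing) auto
      then have tH: "t \<le> \<rho> ^ H" using h by simp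
      have "t powr p \<le> w ^ H" using tH p t unfolding \<rho>w[symmetric] by (intro powr_mono2) auto
      moreover have "0 \<le> t powr p" by simp
      moreover have "F t \<le> F (\<rho> ^ H)" using tH t by (intro F_mono) auto
      ultimately show ?thesis using grid[of H] F_nonneg[of t] t H \<delta> by linarith
    qed
  qed
  define xs where "xs = concat (map (\<lambda>j. replicate (d j) (\<rho> ^ j)) [a..<b])"
  have "(\<Sum>x\<leftarrow>xs. N (t * x)) = F t" for t
    unfolding xs_def sum_list_concat_replicate F_def by (simp add: interv_sum_list_conv_sum_set_nat)
  moreover have "0 < x" if "x \<in> set xs" for x using that \<rho>0 by (auto simp: xs_def)
  ultimately show ?thesis using that[of xs] approx by simp
qed

end

section \<open>Disjoint vectors with the same ordered distribution\<close>

text \<open>\<open>same_ordered_dist\<close> asks for a permutation of all indices, so a bijection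
  between two disjoint supports must be extended; for disjoint sets this extension is an
  involution.\<close>

definition swap_via :: "('a \<Rightarrow> 'a) \<Rightarrow> 'a set \<Rightarrow> 'a set \<Rightarrow> 'a \<Rightarrow> 'a" where
  "swap_via f J K i = (if i \<in> J then f i else if i \<in> K then inv_into J f i else i)"

lemma bij_swap_via:
  assumes f: "bij_betw f J K" and disj: "J \<inter> K = {}"
  shows "bij (swap_via f J K)"
proof (rule involuntory_imp_bij)
  fix i
  show "swap_via f J K (swap_via f J K i) = i"
  proof (cases "i \<in> J")
    case True
    then have "f i \<in> K" "f i \<notin> J" using f disj by (auto simp: bij_betw_def)
    moreover have "inv_into J f (f i) = i" using True f by (simp add: bij_betw_def)
    ultimately show ?thesis using True by (simp add: swap_via_def)
  next
    case i: False
    show ?thesis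
    proof (cases "i \<in> K")
      case True
      then have "inv_into J f i \<in> J" "f (inv_into J f i) = i"
        using f by (auto simp: bij_betw_def inv_into_into f_inv_into_f)
      then show ?thesis using i True by (simp add: swap_via_def)
    qed (use i in \<open>simp add: swap_via_def\<close>)
  qed
qed

lemma same_ordered_dist_refl: "same_ordered_dist x x"
  unfolding same_ordered_dist_def by (intro exI[of _ id]) auto

lemma same_ordered_dist_block_vec:
  assumes "blocks_same_ordered_dist m \<alpha> j k"
    and le: "m (j - 1) \<le> m j" "m (k - 1) \<le> m k"
    and disj: "{m (j - 1)..<m j} \<inter> {m (k - 1)..<m k} = {}"
  shows "same_ordered_dist (block_vec m \<alpha> j) (block_vec m \<alpha> k)"
proof -
  define D where "D = m j - m (j - 1)"
  obtain \<pi> where \<pi>: "\<pi> permutes {0..<D}" "\<And>i. i < D \<Longrightarrow> \<alpha> (m (k - 1) + i) = \<alpha> (m (j - 1) + \<pi> i)"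
    and Dk: "m k - m (k - 1) = D"
    using assms(1) unfolding blocks_same_ordered_dist_def D_def by blast
  let ?J = "{m (j - 1)..<m j}" and ?K = "{m (k - 1)..<m k}"
  \<comment> \<open>The inverse appears because the hypothesis reads block k at i from block j at
    \<open>\<pi> i\<close>, whereas \<open>f\<close> leads from block j to block k.\<close>
  define f where "f i = m (k - 1) + inv \<pi> (i - m (j - 1))" for i
  have \<pi>_lt: "\<pi> i < D" "inv \<pi> i < D" if "i < D" for i
    using that permutes_in_image[OF \<pi>(1), of i] permutes_in_image[OF permutes_inv[OF \<pi>(1)], of i] by auto
  have bij: "bij_betw f ?J ?K"
  proof (rule bij_betwI[where g = "\<lambda>i. m (j - 1) + \<pi> (i - m (k - 1))"])
    show "f \<in> ?J \<rightarrow> ?K"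
    proof
      fix i assume "i \<in> ?J"
      then have "i - m (j - 1) < D" by (auto simp: D_def)
      then show "f i \<in> ?K" unfolding f_def atLeastLessThan_iff
        using \<pi>_lt(2)[of "i - m (j - 1)"] Dk le by linarith
    qed
    show "(\<lambda>i. m (j - 1) + \<pi> (i - m (k - 1))) \<in> ?K \<rightarrow> ?J"
    proof
      fix i assume "i \<in> ?K"
      then have "i - m (k - 1) < D" using Dk by auto
      then show "m (j - 1) + \<pi> (i - m (k - 1)) \<in> ?J" unfolding atLeastLessThan_iff
        using \<pi>_lt(1)[of "i - m (k - 1)"] D_def le by linarith
    qed
  qed (auto simp: f_def permutes_inverses[OF \<pi>(1)])
  have val: "\<alpha> (f i) = \<alpha> i" if "i \<in> ?J" for i
  proof -
    have "i - m (j - 1) < D" using that by (auto simp: D_def)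
    then show ?thesis using \<pi>(2)[of "inv \<pi> (i - m (j - 1))"] \<pi>_lt(2) that
      by (simp add: f_def permutes_inverses[OF \<pi>(1)])
  qed
  have "block_vec m \<alpha> k (swap_via f ?J ?K i) = block_vec m \<alpha> j i" for i
  proof -
    consider "i \<in> ?J" | "i \<in> ?K" "i \<notin> ?J" | "i \<notin> ?J" "i \<notin> ?K" by blast
    then show ?thesis
    proof cases
      case 1
      then have "f i \<in> ?K" using bij by (auto simp: bij_betw_def)
      then show ?thesis using 1 val by (auto simp: swap_via_def block_vec_def)
    next
      case 2
      then have "inv_into ?J f i \<in> ?J" using bij by (metis bij_betw_def inv_into_into)
      then have "inv_into ?J f i \<notin> ?K" using disj by blast
      then show ?thesis using 2 unfolding swap_via_def block_vec_def by auto
    next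
      case 3
      then show ?thesis unfolding swap_via_def block_vec_def by auto
    qed
  qed
  then show ?thesis unfolding same_ordered_dist_def using bij_swap_via[OF bij disj] by blast
qed

lemma block_vec_disjoint_equidistributed:
  assumes m: "\<And>k. k \<in> {1..n} \<Longrightarrow> m (k - 1) < (m k :: nat)"
    and eq: "\<And>j k. j \<in> {1..n} \<Longrightarrow> k \<in> {1..n} \<Longrightarrow> blocks_same_ordered_dist m \<alpha> j k"
    and jk: "j \<in> {1..n}" "k \<in> {1..n}"
  shows "j \<noteq> k \<Longrightarrow> disjoint_supp (block_vec m \<alpha> j) (block_vec m \<alpha> k)"
    and "same_ordered_dist (block_vec m \<alpha> j) (block_vec m \<alpha> k)"
proof -
  have mono: "m i \<le> m k" if "i \<le> k" "k \<le> n" for i k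
    using that
  proof (induction k rule: dec_induct)
    case (step k)
    then show ?case using m[of "Suc k"] by simp
  qed simp
  have disj: "{m (j - 1)..<m j} \<inter> {m (k - 1)..<m k} = {}"
    if "j \<noteq> k" "j \<in> {1..n}" "k \<in> {1..n}" for j k
  proof (cases "j < k")
    case True
    then have "m j \<le> m (k - 1)" using that by (intro mono) auto
    then show ?thesis by auto
  next
    case False
    then have "m k \<le> m (j - 1)" using that by (intro mono) auto
    then show ?thesis by auto
  qed
  show "disjoint_supp (block_vec m \<alpha> j) (block_vec m \<alpha> k)" if "j \<noteq> k"
    using disj[OF that jk] by (auto simp: disjoint_supp_def block_vec_def)
  show "same_ordered_dist (block_vec m \<alpha> j) (block_vec m \<alpha> k)"
    using same_ordered_dist_refl same_ordered_dist_block_vec[OF eq[OF jk]] disj[OF _ jk] m jk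
    by (cases "j = k") (auto simp: less_imp_le)
qed

section \<open>Modulars and norms of disjoint combinations\<close>

context normalized_orlicz
begin

lemma summable_modular_finite_support:
  assumes "finite {i. y i \<noteq> 0}"
  shows "summable (\<lambda>i. N (t * \<bar>y i\<bar>))"
  using assms by (rule summable_finite) (auto simp: N_zero)

text \<open>The modular along the ray through \<open>y\<close>. The norm of a combination of
  disjoint copies of \<open>y\<close> depends on \<open>y\<close> only through this function. The
  value of \<open>suminf\<close> is meaningful only for a convergent series, whence the summability
  assumptions below.\<close>

definition modular :: "(nat \<Rightarrow> real) \<Rightarrow> real \<Rightarrow> real" where
  "modular y t = (\<Sum>i. N (t * \<bar>y i\<bar>))"

lemma modular_zero: "modular y 0 = 0"
  by (simp add: modular_def N_zero)

lemma modular_mono: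
  assumes summ: "\<And>t. 0 \<le> t \<Longrightarrow> summable (\<lambda>i. N (t * \<bar>y i\<bar>))" and "0 \<le> s" "s \<le> t"
  shows "modular y s \<le> modular y t"
  unfolding modular_def using assms by (intro suminf_le summ N_mono mult_right_mono) auto

lemma modular_scale:
  assumes summ: "\<And>t. 0 \<le> t \<Longrightarrow> summable (\<lambda>i. N (t * \<bar>y i\<bar>))" and c: "0 \<le> c" "c \<le> 1" and t: "0 \<le> t"
  shows "modular y (c * t) \<le> c * modular y t"
proof -
  have "modular y (c * t) \<le> (\<Sum>i. c * N (t * \<bar>y i\<bar>))"
    unfolding modular_def using c t N_scale[OF c, of "t * \<bar>y _\<bar>"]
    by (intro suminf_le summ summable_mult) (auto simp: mult.assoc)
  also have "\<dots> = c * modular y t" unfolding modular_def using t by (intro suminf_mult summ)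
  finally show ?thesis .
qed

lemma modular_nonneg:
  assumes summ: "\<And>t. 0 \<le> t \<Longrightarrow> summable (\<lambda>i. N (t * \<bar>y i\<bar>))" and t: "0 \<le> t"
  shows "0 \<le> modular y t"
  using modular_mono[OF summ order_refl t] modular_zero by simp

lemma in_orlicz_finite_support:
  assumes fin: "finite {i. y i \<noteq> 0}"
  shows "in_orlicz N y"
proof -
  have summ: "summable (\<lambda>i. N (t * \<bar>y i\<bar>))" for t using fin by (rule summable_modular_finite_support)
  define u where "u = 1 + modular y 1"
  have u: "1 \<le> u" "modular y 1 \<le> u" using modular_nonneg[OF summ, of 1] by (auto simp: u_def)
  have "modular y (1 / u * 1) \<le> 1 / u * modular y 1" using u by (intro modular_scale summ) auto
  also have "\<dots> \<le> 1" using u by simp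
  finally have "u \<in> orlicz_admissible N y"
    using u summ[of "1 / u"] by (simp add: orlicz_admissible_def modular_def)
  then show ?thesis by (auto simp: in_orlicz_def)
qed

text \<open>At each index at most one \<open>x k\<close> is nonzero, so N of the combination splits
  into a sum over k; rearranging a series of nonnegative terms then replaces every
  \<open>x k\<close> by \<open>y\<close>.\<close>

lemma lin_comb_modular_sums:
  assumes disj: "\<And>j k. j \<in> {1..n} \<Longrightarrow> k \<in> {1..n} \<Longrightarrow> j \<noteq> k \<Longrightarrow> disjoint_supp (x j) (x k)"
    and same: "\<And>k. k \<in> {1..n} \<Longrightarrow> same_ordered_dist y (x k)"
    and summ: "\<And>t. 0 \<le> t \<Longrightarrow> summable (\<lambda>i. N (t * \<bar>y i\<bar>))" and u: "0 < u"
  shows "(\<lambda>i. N (\<bar>lin_comb n a x i\<bar> / u)) sums (\<Sum>k=1..n. modular y (\<bar>a k\<bar> / u))"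
proof -
  have "(\<lambda>i. N (\<bar>a k\<bar> / u * \<bar>x k i\<bar>)) sums modular y (\<bar>a k\<bar> / u)" if k: "k \<in> {1..n}" for k
  proof -
    obtain \<pi> where \<pi>: "bij \<pi>" "\<And>i. x k (\<pi> i) = y i"
      using same[OF k] unfolding same_ordered_dist_def by blast
    have "(\<lambda>i. N (\<bar>a k\<bar> / u * \<bar>y i\<bar>)) sums modular y (\<bar>a k\<bar> / u)"
      unfolding modular_def using u by (intro summable_sums summ) auto
    then have "((\<lambda>i. N (\<bar>a k\<bar> / u * \<bar>y i\<bar>)) has_sum modular y (\<bar>a k\<bar> / u)) UNIV"
      using u by (intro sums_nonneg_imp_has_sum N_nonneg) auto
    then have "((\<lambda>i. N (\<bar>a k\<bar> / u * \<bar>x k (\<pi> i)\<bar>)) has_sum modular y (\<bar>a k\<bar> / u)) UNIV"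
      by (simp add: \<pi>(2))
    then have "((\<lambda>i. N (\<bar>a k\<bar> / u * \<bar>x k i\<bar>)) has_sum modular y (\<bar>a k\<bar> / u)) UNIV"
      using has_sum_reindex_bij_betw[OF \<pi>(1), of "\<lambda>i. N (\<bar>a k\<bar> / u * \<bar>x k i\<bar>)"] by simp
    then show ?thesis by (rule has_sum_imp_sums)
  qed
  then have "(\<lambda>i. \<Sum>k=1..n. N (\<bar>a k\<bar> / u * \<bar>x k i\<bar>)) sums (\<Sum>k=1..n. modular y (\<bar>a k\<bar> / u))"
    by (rule sums_sum)
  moreover have "(\<Sum>k=1..n. N (\<bar>a k\<bar> / u * \<bar>x k i\<bar>)) = N (\<bar>lin_comb n a x i\<bar> / u)" for i
  proof (cases "\<exists>k0\<in>{1..n}. x k0 i \<noteq> 0")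
    case True
    then obtain k0 where k0: "k0 \<in> {1..n}" "x k0 i \<noteq> 0" by blast
    have z: "x k i = 0" if "k \<in> {1..n} - {k0}" for k
      using disj[of k k0] that k0 by (auto simp: disjoint_supp_def)
    have "lin_comb n a x i = a k0 * x k0 i"
      unfolding lin_comb_def using k0 z by (subst sum.remove[OF _ k0(1)]) auto
    moreover have "(\<Sum>k=1..n. N (\<bar>a k\<bar> / u * \<bar>x k i\<bar>)) = N (\<bar>a k0\<bar> / u * \<bar>x k0 i\<bar>)"
      using k0 z by (subst sum.remove[OF _ k0(1)]) (auto simp: N_zero)
    ultimately show ?thesis by (simp add: abs_mult)
  next
    case False
    then show ?thesis by (simp add: lin_comb_def N_zero)
  qed
  ultimately show ?thesis by simp
qed

lemma orlicz_norm_lin_comb: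
  assumes disj: "\<And>j k. j \<in> {1..n} \<Longrightarrow> k \<in> {1..n} \<Longrightarrow> j \<noteq> k \<Longrightarrow> disjoint_supp (x j) (x k)"
    and same: "\<And>k. k \<in> {1..n} \<Longrightarrow> same_ordered_dist y (x k)"
    and summ: "\<And>t. 0 \<le> t \<Longrightarrow> summable (\<lambda>i. N (t * \<bar>y i\<bar>))"
  shows "0 \<le> orlicz_norm N (lin_comb n a x)"
    and "0 < u \<Longrightarrow> orlicz_norm N (lin_comb n a x) < u \<Longrightarrow> (\<Sum>k=1..n. modular y (\<bar>a k\<bar> / u)) \<le> 1"
    and "0 < u \<Longrightarrow> (\<Sum>k=1..n. modular y (\<bar>a k\<bar> / u)) \<le> 1 \<Longrightarrow> orlicz_norm N (lin_comb n a x) \<le> u"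
proof -
  let ?S = "orlicz_admissible N (lin_comb n a x)"
  have iff: "u \<in> ?S \<longleftrightarrow> 0 < u \<and> (\<Sum>k=1..n. modular y (\<bar>a k\<bar> / u)) \<le> 1" for u
    using lin_comb_modular_sums[OF disj same summ, where u = u and a = a]
    by (auto simp: orlicz_admissible_def sums_iff)
  have nonneg: "0 \<le> modular y t" if "0 \<le> t" for t using modular_nonneg[OF summ that] .
  \<comment> \<open>An admissible level, by \<open>modular_scale\<close>: \<open>Inf\<close> carries
    no information about an empty set.\<close>
  define u0 where "u0 = 1 + (\<Sum>k=1..n. modular y \<bar>a k\<bar>)"
  have u0: "1 \<le> u0" unfolding u0_def by (simp add: sum_nonneg nonneg)
  have "(\<Sum>k=1..n. modular y (1 / u0 * \<bar>a k\<bar>)) \<le> (\<Sum>k=1..n. 1 / u0 * modular y \<bar>a k\<bar>)"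
    using u0 by (intro sum_mono modular_scale summ) auto
  also have "\<dots> = (u0 - 1) / u0" by (simp add: u0_def sum_divide_distrib)
  also have "\<dots> \<le> 1" using u0 by simp
  finally have "u0 \<in> ?S" using u0 iff by simp
  then have ne: "?S \<noteq> {}" by blast
  have bdd: "bdd_below ?S" by (intro bdd_belowI[of _ 0]) (auto simp: orlicz_admissible_def)
  show "0 \<le> orlicz_norm N (lin_comb n a x)"
    unfolding orlicz_norm_def using ne by (intro cInf_greatest) (auto simp: orlicz_admissible_def)
  show "orlicz_norm N (lin_comb n a x) \<le> u" if "0 < u" "(\<Sum>k=1..n. modular y (\<bar>a k\<bar> / u)) \<le> 1"
    unfolding orlicz_norm_def using bdd iff that by (intro cInf_lower) auto
  show "(\<Sum>k=1..n. modular y (\<bar>a k\<bar> / u)) \<le> 1" if u: "0 < u" "orlicz_norm N (lin_comb n a x) < u"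
  proof -
    obtain v where v: "v \<in> ?S" "v < u" using cInf_lessD[OF ne] u unfolding orlicz_norm_def by blast
    then have "0 < v" using iff by blast
    then have "(\<Sum>k=1..n. modular y (\<bar>a k\<bar> / u)) \<le> (\<Sum>k=1..n. modular y (\<bar>a k\<bar> / v))"
      using v u by (intro sum_mono modular_mono summ divide_left_mono) auto
    also have "\<dots> \<le> 1" using v iff by blast
    finally show ?thesis .
  qed
qed

text \<open>At the level of the l^p norm R every |a k|/R lies in [0,1], so the modulars sum to 1 up
  to n \<open>\<eta>\<close>. By convexity, changing the level by the factor 1 +
  \<open>\<epsilon>\<close> changes the sum by at least that factor, which outweighs the additive
  error.\<close>

lemma lp_equivalence_if_modular_approx:
  assumes disj: "\<And>j k. j \<in> {1..n} \<Longrightarrow> k \<in> {1..n} \<Longrightarrow> j \<noteq> k \<Longrightarrow> disjoint_supp (x j) (x k)"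
    and same: "\<And>k. k \<in> {1..n} \<Longrightarrow> same_ordered_dist y (x k)"
    and summ: "\<And>t. 0 \<le> t \<Longrightarrow> summable (\<lambda>i. N (t * \<bar>y i\<bar>))"
    and p: "1 \<le> p" and n: "1 \<le> n" and \<epsilon>: "0 < \<epsilon>"
    and \<eta>: "real n * \<eta> * (1 + \<epsilon>) < \<epsilon>" "0 \<le> \<eta>"
    and approx: "\<And>t. 0 \<le> t \<Longrightarrow> t \<le> 1 \<Longrightarrow> \<bar>modular y t - t powr p\<bar> \<le> \<eta>"
  shows "lp_norm (ereal p) n a / (1 + \<epsilon>) \<le> orlicz_norm N (lin_comb n a x)"
    and "orlicz_norm N (lin_comb n a x) \<le> (1 + \<epsilon>) * lp_norm (ereal p) n a"
proof -
  note norm = orlicz_norm_lin_comb[where n = n and x = x and y = y, OF disj same summ]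
  define P where "P = (\<Sum>k=1..n. \<bar>a k\<bar> powr p)"
  define R where "R = lp_norm (ereal p) n a"
  have R: "R = P powr (1 / p)" by (simp add: R_def lp_norm_def P_def)
  have P0: "0 \<le> P" unfolding P_def by (intro sum_nonneg) auto
  have R0: "0 \<le> R" by (simp add: R)
  have Rp: "R powr p = P" using P0 p by (simp add: R powr_powr)
  have le_R: "\<bar>a k\<bar> \<le> R" if "k \<in> {1..n}" for k
  proof -
    have "\<bar>a k\<bar> powr p \<le> P" unfolding P_def using that
      by (intro member_le_sum[where f = "\<lambda>k. \<bar>a k\<bar> powr p"]) auto
    then have "(\<bar>a k\<bar> powr p) powr (1 / p) \<le> R" unfolding R using p by (intro powr_mono2) auto
    then show ?thesis using p by (simp add: powr_powr)
  qed
  have sum_powr: "(\<Sum>k=1..n. (\<bar>a k\<bar> / v) powr p) = P / v powr p" if "0 < v" for v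
    using that by (simp add: P_def powr_divide sum_divide_distrib)
  show "orlicz_norm N (lin_comb n a x) \<le> (1 + \<epsilon>) * lp_norm (ereal p) n a"
    unfolding R_def[symmetric]
  \<comment> \<open>Taking every u above the bound keeps the level positive even when R = 0.\<close>
  proof (rule dense_ge)
    fix u assume u: "(1 + \<epsilon>) * R < u"
    have "0 \<le> (1 + \<epsilon>) * R" using R0 \<epsilon> by simp
    then have u0: "0 < u" using u by linarith
    define v where "v = u / (1 + \<epsilon>)"
    have v: "0 < v" "R \<le> v" using u u0 \<epsilon> by (auto simp: v_def field_simps)
    have "(\<Sum>k=1..n. modular y (\<bar>a k\<bar> / u)) \<le> (\<Sum>k=1..n. 1 / (1 + \<epsilon>) * ((\<bar>a k\<bar> / v) powr p + \<eta>))"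
    proof (rule sum_mono)
      fix k assume k: "k \<in> {1..n}"
      have b: "0 \<le> \<bar>a k\<bar> / v" "\<bar>a k\<bar> / v \<le> 1" using v le_R[OF k] by auto
      have "modular y (\<bar>a k\<bar> / u) = modular y (1 / (1 + \<epsilon>) * (\<bar>a k\<bar> / v))"
        using \<epsilon> by (simp add: v_def)
      also have "\<dots> \<le> 1 / (1 + \<epsilon>) * modular y (\<bar>a k\<bar> / v)"
        using \<epsilon> b by (intro modular_scale summ) auto
      also have "\<dots> \<le> 1 / (1 + \<epsilon>) * ((\<bar>a k\<bar> / v) powr p + \<eta>)"
      proof (rule mult_left_mono)
        show "modular y (\<bar>a k\<bar> / v) \<le> (\<bar>a k\<bar> / v) powr p + \<eta>" using approx[OF b] by linarith
      qed (use \<epsilon> in simp)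
      finally show "modular y (\<bar>a k\<bar> / u) \<le> 1 / (1 + \<epsilon>) * ((\<bar>a k\<bar> / v) powr p + \<eta>)" .
    qed
    also have "\<dots> = 1 / (1 + \<epsilon>) * (P / v powr p + real n * \<eta>)"
      unfolding sum_distrib_left[symmetric] sum.distrib sum_powr[OF v(1)] by simp
    also have "\<dots> \<le> 1 / (1 + \<epsilon>) * (1 + \<epsilon>)"
    proof (intro mult_left_mono add_mono)
      have "P \<le> v powr p" unfolding Rp[symmetric] using v R0 p by (intro powr_mono2) auto
      then show "P / v powr p \<le> 1" using v by simp
      have "real n * \<eta> * 1 \<le> real n * \<eta> * (1 + \<epsilon>)" using \<epsilon> \<eta> by (intro mult_left_mono) auto
      then show "real n * \<eta> \<le> \<epsilon>" using \<eta> by simp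
    qed (use \<epsilon> in simp)
    finally show "orlicz_norm N (lin_comb n a x) \<le> u" using u0 \<epsilon> by (intro norm(3)) auto
  qed
  show "lp_norm (ereal p) n a / (1 + \<epsilon>) \<le> orlicz_norm N (lin_comb n a x)"
    unfolding R_def[symmetric]
  proof (rule ccontr)
    assume less: "\<not> R / (1 + \<epsilon>) \<le> orlicz_norm N (lin_comb n a x)"
    define u where "u = R / (1 + \<epsilon>)"
    have "0 < u" using less norm(1)[where a = a] unfolding u_def by linarith
    then have "0 < R" using \<epsilon> by (simp add: u_def zero_less_divide_iff)
    have "(\<Sum>k=1..n. (1 + \<epsilon>) * ((\<bar>a k\<bar> / R) powr p - \<eta>)) \<le> (\<Sum>k=1..n. modular y (\<bar>a k\<bar> / u))"
    proof (rule sum_mono)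
      fix k assume k: "k \<in> {1..n}"
      have b: "0 \<le> \<bar>a k\<bar> / R" "\<bar>a k\<bar> / R \<le> 1" using \<open>0 < R\<close> le_R[OF k] by auto
      have "(\<bar>a k\<bar> / R) powr p - \<eta> \<le> modular y (\<bar>a k\<bar> / R)" using approx[OF b] by linarith
      also have "\<dots> = modular y (1 / (1 + \<epsilon>) * (\<bar>a k\<bar> / u))" using \<epsilon> by (simp add: u_def)
      also have "\<dots> \<le> 1 / (1 + \<epsilon>) * modular y (\<bar>a k\<bar> / u)"
        using \<epsilon> \<open>0 < u\<close> by (intro modular_scale summ) auto
      finally show "(1 + \<epsilon>) * ((\<bar>a k\<bar> / R) powr p - \<eta>) \<le> modular y (\<bar>a k\<bar> / u)"
        using \<epsilon> by (simp add: field_simps)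
    qed
    also have "\<dots> \<le> 1" using less \<open>0 < u\<close> by (intro norm(2)) (auto simp: u_def)
    finally have "(1 + \<epsilon>) * (P / R powr p - real n * \<eta>) \<le> 1"
      unfolding sum_distrib_left[symmetric] sum_subtractf sum_powr[OF \<open>0 < R\<close>] by simp
    moreover have "P / R powr p = 1" using \<open>0 < R\<close> by (simp add: Rp[symmetric])
    ultimately show False using \<eta>(1) by (simp add: algebra_simps)
  qed
qed

section \<open>From approximated powers to representations of l^p\<close>

lemma sym_block_fin_rep_if_no_powers:
  assumes p: "1 \<le> p"
    and no_upper: "\<And>q. p < q \<Longrightarrow> \<not> upper_power q"
    and no_lower: "\<And>q. 0 < q \<Longrightarrow> q < p \<Longrightarrow> \<not> lower_power q"
  shows "sym_block_fin_rep N (ereal p)"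
  unfolding sym_block_fin_rep_def
proof (intro allI impI)
  fix n :: nat and \<epsilon> :: real assume n: "1 \<le> n" and \<epsilon>: "0 < \<epsilon>"
  define \<eta> where "\<eta> = \<epsilon> / (2 * real n * (1 + \<epsilon>))"
  have \<eta>: "0 < \<eta>" using n \<epsilon> by (simp add: \<eta>_def)
  have "real n * (\<epsilon> / (2 * real n * c)) * c = \<epsilon> / 2" if "0 < c" for c
    using that n by simp
  from this[of "1 + \<epsilon>"] have half: "real n * \<eta> * (1 + \<epsilon>) = \<epsilon> / 2"
    using \<epsilon> unfolding \<eta>_def by linarith
  then have n\<eta>: "real n * \<eta> * (1 + \<epsilon>) < \<epsilon>" using \<epsilon> by linarith
  obtain xs where pos: "\<And>x. x \<in> set xs \<Longrightarrow> 0 < x"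
    and approx: "\<And>t. 0 \<le> t \<Longrightarrow> t \<le> 1 \<Longrightarrow> \<bar>(\<Sum>x\<leftarrow>xs. N (t * x)) - t powr p\<bar> \<le> \<eta>"
    using power_approximation[OF p \<eta> no_upper no_lower] by blast
  \<comment> \<open>Excludes the empty list, whose error at t = 1 would be 1: the blocks must have
    positive length.\<close>
  have "\<eta> < 1"
  proof -
    have "\<eta> * (1 + \<epsilon>) \<le> real n * \<eta> * (1 + \<epsilon>)" using n \<epsilon> \<eta> by (intro mult_right_mono) auto
    also have "\<dots> < 1 * (1 + \<epsilon>)" unfolding half using \<epsilon> by simp
    finally show ?thesis using \<epsilon> by (subst (asm) mult_less_cancel_right_pos) auto
  qed
  define D where "D = length xs"
  have D: "0 < D"
  proof (rule ccontr)
    assume "\<not> 0 < D"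
    then have "xs = []" by (simp add: D_def)
    then show False using approx[of 1] \<open>\<eta> < 1\<close> by simp
  qed
  define m :: "nat \<Rightarrow> nat" where "m k = k * D" for k
  \<comment> \<open>All blocks are translates of one another, so the identity permutation relates
    them.\<close>
  define \<alpha> where "\<alpha> i = xs ! (i mod D)" for i
  have m_step: "m (k - 1) < m k" and m_diff: "m k - m (k - 1) = D" if "k \<in> {1..n}" for k
  proof -
    have "k = Suc (k - 1)" using that by simp
    then obtain l where "k = Suc l" by blast
    then show "m (k - 1) < m k" "m k - m (k - 1) = D" using D by (auto simp: m_def)
  qed
  have blocks: "blocks_same_ordered_dist m \<alpha> j k" if "j \<in> {1..n}" "k \<in> {1..n}" for j k
    unfolding blocks_same_ordered_dist_def m_diff[OF that(1)] m_diff[OF that(2)]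
    by (intro conjI exI[of _ id] permutes_id refl allI impI) (simp add: \<alpha>_def m_def)
  note block = block_vec_disjoint_equidistributed[of n m \<alpha>, OF m_step blocks]
  define y where "y = block_vec m \<alpha> 1"
  have y: "y i = (if i < D then xs ! i else 0)" for i by (simp add: y_def block_vec_def m_def \<alpha>_def)
  have "finite {i. y i \<noteq> 0}" by (rule finite_subset[of _ "{..<D}"]) (auto simp: y split: if_splits)
  then have summ: "summable (\<lambda>i. N (t * \<bar>y i\<bar>))" for t by (rule summable_modular_finite_support)
  have "modular y t = (\<Sum>x\<leftarrow>xs. N (t * x))" for t
  proof -
    have "modular y t = (\<Sum>i<D. N (t * \<bar>y i\<bar>))"
      unfolding modular_def by (rule suminf_finite) (auto simp: y N_zero)
    also have "\<dots> = (\<Sum>i<D. N (t * xs ! i))"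
      by (intro sum.cong) (auto simp: y D_def abs_of_pos[OF pos[OF nth_mem]])
    also have "\<dots> = (\<Sum>x\<leftarrow>xs. N (t * x))" by (simp add: sum_list_sum_nth D_def atLeast0LessThan)
    finally show ?thesis .
  qed
  then have approx_y: "\<bar>modular y t - t powr p\<bar> \<le> \<eta>" if "0 \<le> t" "t \<le> 1" for t
    using approx that by simp
  have same: "same_ordered_dist y (block_vec m \<alpha> k)" if "k \<in> {1..n}" for k
    unfolding y_def using that n by (intro block(2)) auto
  note equiv = lp_equivalence_if_modular_approx[where x = "block_vec m \<alpha>",
      OF block(1) same summ p n \<epsilon> n\<eta> less_imp_le[OF \<eta>] approx_y]
  show "\<exists>m \<alpha>. m 0 = 0 \<and> (\<forall>k \<in> {1..n}. m (k - 1) < m k) \<and>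
        (\<forall>j \<in> {1..n}. \<forall>k \<in> {1..n}. blocks_same_ordered_dist m \<alpha> j k) \<and>
        (\<forall>a. lp_norm (ereal p) n a / (1 + \<epsilon>) \<le> orlicz_norm N (lin_comb n a (block_vec m \<alpha>)) \<and>
             orlicz_norm N (lin_comb n a (block_vec m \<alpha>)) \<le> (1 + \<epsilon>) * lp_norm (ereal p) n a)"
    using m_step blocks equiv by (intro exI[of _ m] exI[of _ \<alpha>]) (auto simp: m_def)
qed

lemma sym_fin_rep_if_sym_block_fin_rep:
  assumes "sym_block_fin_rep N p"
  shows "sym_fin_rep N p"
  unfolding sym_fin_rep_def
proof (intro allI impI)
  fix n :: nat and \<epsilon> :: real assume "1 \<le> n" "0 < \<epsilon>"
  then obtain m \<alpha> where m: "\<forall>k \<in> {1..n}. m (k - 1) < m k"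
    and blocks: "\<forall>j \<in> {1..n}. \<forall>k \<in> {1..n}. blocks_same_ordered_dist m \<alpha> j k"
    and est: "\<forall>a. lp_norm p n a / (1 + \<epsilon>) \<le> orlicz_norm N (lin_comb n a (block_vec m \<alpha>)) \<and>
             orlicz_norm N (lin_comb n a (block_vec m \<alpha>)) \<le> (1 + \<epsilon>) * lp_norm p n a"
    using assms unfolding sym_block_fin_rep_def by blast
  have "finite {i. block_vec m \<alpha> k i \<noteq> 0}" for k
    by (rule finite_subset[of _ "{..<m k}"]) (auto simp: block_vec_def split: if_splits)
  then have mem: "in_orlicz N (block_vec m \<alpha> k)" for k by (rule in_orlicz_finite_support)
  have disj: "disjoint_supp (block_vec m \<alpha> j) (block_vec m \<alpha> k)"
    if "j \<in> {1..n}" "k \<in> {1..n}" "j \<noteq> k" for j k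
    using m blocks that by (intro block_vec_disjoint_equidistributed(1)) blast+
  have same: "same_ordered_dist (block_vec m \<alpha> j) (block_vec m \<alpha> k)"
    if "j \<in> {1..n}" "k \<in> {1..n}" for j k
    using m blocks that by (intro block_vec_disjoint_equidistributed(2)) blast+
  show "\<exists>x :: nat \<Rightarrow> nat \<Rightarrow> real.
        (\<forall>k \<in> {1..n}. in_orlicz N (x k)) \<and>
        (\<forall>j \<in> {1..n}. \<forall>k \<in> {1..n}. j \<noteq> k \<longrightarrow> disjoint_supp (x j) (x k)) \<and>
        (\<forall>j \<in> {1..n}. \<forall>k \<in> {1..n}. same_ordered_dist (x j) (x k)) \<and>
        (\<forall>a. lp_norm p n a / (1 + \<epsilon>) \<le> orlicz_norm N (lin_comb n a x) \<and>
             orlicz_norm N (lin_comb n a x) \<le> (1 + \<epsilon>) * lp_norm p n a)"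
    using mem disj same est by (intro exI[of _ "block_vec m \<alpha>"] conjI ballI impI) simp_all
qed

lemma crude_sym_fin_rep_if_sym_fin_rep:
  assumes "sym_fin_rep N p"
  shows "crude_sym_fin_rep N p"
proof -
  have "\<forall>n\<ge>1. \<exists>x :: nat \<Rightarrow> nat \<Rightarrow> real.
        (\<forall>k \<in> {1..n}. in_orlicz N (x k)) \<and>
        (\<forall>j \<in> {1..n}. \<forall>k \<in> {1..n}. j \<noteq> k \<longrightarrow> disjoint_supp (x j) (x k)) \<and>
        (\<forall>j \<in> {1..n}. \<forall>k \<in> {1..n}. same_ordered_dist (x j) (x k)) \<and>
        (\<forall>a. lp_norm p n a / (1 + 1) \<le> orlicz_norm N (lin_comb n a x) \<and>
             orlicz_norm N (lin_comb n a x) \<le> (1 + 1) * lp_norm p n a)"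
    using assms[unfolded sym_fin_rep_def, THEN spec, THEN mp, THEN spec[of _ 1], THEN mp, OF _ zero_less_one]
    by (intro allI impI) assumption
  then show ?thesis unfolding crude_sym_fin_rep_def by (intro exI[of _ "1 + 1"]) auto
qed

end

section \<open>The equivalence\<close>

context normalized_orlicz
begin

text \<open>A Delta_2 condition. If M z <= 1, apply the lower estimate at M z with ratio 1/M.
  Otherwise z > 1/M, and N(M) and N(1/M) bound the two sides.\<close>

lemma dilation_bound:
  assumes low: "lower_power r" and M: "1 \<le> M"
  shows "\<exists>K>0. \<forall>z. 0 \<le> z \<longrightarrow> z \<le> 1 \<longrightarrow> N (M * z) \<le> K * N z"
proof -
  obtain c where c: "0 < c"
    and *: "\<And>s t. 0 < s \<Longrightarrow> s \<le> 1 \<Longrightarrow> 0 < t \<Longrightarrow> t \<le> 1 \<Longrightarrow> c * t powr r * N s \<le> N (s * t)"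
    using low unfolding lower_power_def by blast
  define K1 where "K1 = 1 / (c * (1 / M) powr r)"
  define K2 where "K2 = N M / N (1 / M)"
  have K: "0 < K1" "0 < K2" using c M N_pos by (simp_all add: K1_def K2_def)
  have "N (M * z) \<le> (K1 + K2) * N z" if z: "0 \<le> z" "z \<le> 1" for z
  proof (cases "z = 0")
    case True
    then show ?thesis by (simp add: N_zero)
  next
    case False
    have Nz: "0 < N z" using False z N_pos by simp
    have "N (M * z) \<le> K1 * N z \<or> N (M * z) \<le> K2 * N z"
    proof (cases "M * z \<le> 1")
      case True
      have "c * (1 / M) powr r * N (M * z) \<le> N (M * z * (1 / M))"
        using True False z M by (intro *) auto
      then have "c * (1 / M) powr r * N (M * z) \<le> N z" using M by simp
      then show ?thesis using c M by (simp add: K1_def field_simps)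
    next
      case False
      have "N (M * z) \<le> N M" using z M by (intro N_mono) auto
      also have "\<dots> = K2 * N (1 / M)" using N_pos[of "1 / M"] M by (simp add: K2_def)
      also have "\<dots> \<le> K2 * N z" using False M K by (intro mult_left_mono N_mono) (auto simp: field_simps)
      finally show ?thesis by simp
    qed
    then show ?thesis using Nz K by (auto simp: distrib_right intro: order_trans)
  qed
  then show ?thesis using K by (intro exI[of _ "K1 + K2"]) auto
qed

text \<open>Membership gives summability at one scale 1/u only. There each term is at most 1 = N(1),
  so the arguments lie in [0,1] and \<open>dilation_bound\<close> reaches every other scale.\<close>

lemma modular_summable_if_in_orlicz:
  assumes low: "lower_power r" and y: "in_orlicz N y" and t: "0 \<le> t"
  shows "summable (\<lambda>i. N (t * \<bar>y i\<bar>))"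
proof -
  obtain u where u: "0 < u" "summable (\<lambda>i. N (\<bar>y i\<bar> / u))" "(\<Sum>i. N (\<bar>y i\<bar> / u)) \<le> 1"
    using y by (auto simp: in_orlicz_def orlicz_admissible_def)
  have le1: "\<bar>y i\<bar> / u \<le> 1" for i
  proof -
    have "(\<Sum>i\<in>{i}. N (\<bar>y i\<bar> / u)) \<le> (\<Sum>i. N (\<bar>y i\<bar> / u))"
      using u N_nonneg by (intro sum_le_suminf) auto
    then have "N (\<bar>y i\<bar> / u) \<le> N 1" using u N_one by simp
    then show ?thesis using u by (subst (asm) N_le_iff) auto
  qed
  obtain K where K: "\<And>z. 0 \<le> z \<Longrightarrow> z \<le> 1 \<Longrightarrow> N (max 1 (t * u) * z) \<le> K * N z"
    using dilation_bound[OF low, of "max 1 (t * u)"] by auto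
  have "N (t * \<bar>y i\<bar>) \<le> K * N (\<bar>y i\<bar> / u)" for i
  proof -
    have "t * \<bar>y i\<bar> = t * u * (\<bar>y i\<bar> / u)" using u by simp
    also have "\<dots> \<le> max 1 (t * u) * (\<bar>y i\<bar> / u)" using u by (intro mult_right_mono) auto
    finally have "N (t * \<bar>y i\<bar>) \<le> N (max 1 (t * u) * (\<bar>y i\<bar> / u))" using t by (intro N_mono) auto
    also have "\<dots> \<le> K * N (\<bar>y i\<bar> / u)" using u le1[of i] by (intro K) auto
    finally show ?thesis .
  qed
  then show ?thesis using t N_nonneg
    by (intro summable_comparison_test'[OF summable_mult[OF u(2), of K]]) auto
qed

text \<open>\<open>y\<close> varies with n but \<open>D\<close> does not, so a contradiction must
  come from estimates uniform in \<open>y\<close>. The unit vector fixes the size of the modular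
  near scale 1, the all-ones vector its order 1/n near the reciprocal of that vector's l^p
  norm.\<close>

lemma crude_sym_fin_rep_modular:
  assumes low: "lower_power r" and crude: "crude_sym_fin_rep N p" and p: "1 \<le> p"
  obtains D where "1 \<le> D" "\<And>n. 1 \<le> n \<Longrightarrow> \<exists>y. (\<forall>t\<ge>0. summable (\<lambda>i. N (t * \<bar>y i\<bar>))) \<and>
    modular y (1 / D) \<le> 1 \<and> 1 < modular y D \<and>
    real n * modular y (1 / (D * lp_norm p n (\<lambda>_. 1))) \<le> 1 \<and>
    1 < real n * modular y (D / lp_norm p n (\<lambda>_. 1))"
proof -
  obtain C where C: "0 < C" and ex: "\<And>n. n \<ge> 1 \<Longrightarrow> \<exists>x :: nat \<Rightarrow> nat \<Rightarrow> real.
        (\<forall>k \<in> {1..n}. in_orlicz N (x k)) \<and>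
        (\<forall>j \<in> {1..n}. \<forall>k \<in> {1..n}. j \<noteq> k \<longrightarrow> disjoint_supp (x j) (x k)) \<and>
        (\<forall>j \<in> {1..n}. \<forall>k \<in> {1..n}. same_ordered_dist (x j) (x k)) \<and>
        (\<forall>a. lp_norm p n a / C \<le> orlicz_norm N (lin_comb n a x) \<and>
             orlicz_norm N (lin_comb n a x) \<le> C * lp_norm p n a)"
    using crude unfolding crude_sym_fin_rep_def by blast
  have ones_pos: "0 < lp_norm p n (\<lambda>_. 1)" if "1 \<le> n" for n
    using that p by (cases p) (auto simp: lp_norm_def)
  have unit: "lp_norm p n (\<lambda>k. if k = 1 then 1 else 0) = 1" if n: "1 \<le> n" for n
  proof (cases p)
    case (real q)
    have "(\<Sum>k=1..n. \<bar>if k = 1 then 1 else (0 :: real)\<bar> powr q) = (\<Sum>k=1..n. if k = 1 then 1 else 0)"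
      by (intro sum.cong) auto
    then show ?thesis using n real by (simp add: lp_norm_def)
  next
    case PInf
    have "Max (insert 0 ((\<lambda>k. \<bar>if k = 1 then 1 else (0 :: real)\<bar>) ` {1..n})) = 1"
      using n by (intro Max_eqI) auto
    then show ?thesis using PInf by (simp add: lp_norm_def)
  qed (use p in auto)
  \<comment> \<open>D > C makes the norm bounds strict, as the passage to modulars requires.\<close>
  define D where "D = max 1 (2 * C)"
  have D: "1 \<le> D" "C < D" using C by (auto simp: D_def)
  have "\<exists>y. (\<forall>t\<ge>0. summable (\<lambda>i. N (t * \<bar>y i\<bar>))) \<and>
    modular y (1 / D) \<le> 1 \<and> 1 < modular y D \<and>
    real n * modular y (1 / (D * lp_norm p n (\<lambda>_. 1))) \<le> 1 \<and>
    1 < real n * modular y (D / lp_norm p n (\<lambda>_. 1))" if n: "1 \<le> n" for n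
  proof -
    from ex[OF n] obtain x :: "nat \<Rightarrow> nat \<Rightarrow> real" where x: "\<forall>k \<in> {1..n}. in_orlicz N (x k)"
      "\<forall>j \<in> {1..n}. \<forall>k \<in> {1..n}. j \<noteq> k \<longrightarrow> disjoint_supp (x j) (x k)"
      "\<forall>j \<in> {1..n}. \<forall>k \<in> {1..n}. same_ordered_dist (x j) (x k)"
      "\<forall>a. lp_norm p n a / C \<le> orlicz_norm N (lin_comb n a x) \<and>
         orlicz_norm N (lin_comb n a x) \<le> C * lp_norm p n a"
      by (elim exE conjE) (rule that)
    have mem: "in_orlicz N (x k)" if "k \<in> {1..n}" for k
      using x(1) that by blast
    have disj: "disjoint_supp (x j) (x k)" if "j \<in> {1..n}" "k \<in> {1..n}" "j \<noteq> k" for j k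
      using x(2) that by blast
    have same: "same_ordered_dist (x j) (x k)" if "j \<in> {1..n}" "k \<in> {1..n}" for j k
      using x(3) that by blast
    have lower: "lp_norm p n a / C \<le> orlicz_norm N (lin_comb n a x)"
      and upper: "orlicz_norm N (lin_comb n a x) \<le> C * lp_norm p n a" for a
      using x(4) by blast+
    define y where "y = x 1"
    have same_y: "same_ordered_dist y (x k)" if "k \<in> {1..n}" for k
      unfolding y_def using same that n by simp
    have summ: "summable (\<lambda>i. N (t * \<bar>y i\<bar>))" if "0 \<le> t" for t
      unfolding y_def using modular_summable_if_in_orlicz[OF low mem that] n by simp
    note norm = orlicz_norm_lin_comb[where n = n and x = x and y = y, OF disj same_y summ]
    have le1: "(\<Sum>k=1..n. modular y (\<bar>a k\<bar> / (D * lp_norm p n a))) \<le> 1"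
      if "0 < lp_norm p n a" for a
    proof (rule norm(2))
      show "0 < D * lp_norm p n a" using that D by simp
      have "C * lp_norm p n a < D * lp_norm p n a" using that D by simp
      then show "orlicz_norm N (lin_comb n a x) < D * lp_norm p n a" using upper[of a] by simp
    qed
    have gt1: "1 < (\<Sum>k=1..n. modular y (\<bar>a k\<bar> / (lp_norm p n a / D)))"
      if R: "0 < lp_norm p n a" for a
    proof (rule ccontr)
      assume "\<not> ?thesis"
      then have "orlicz_norm N (lin_comb n a x) \<le> lp_norm p n a / D"
        using R D by (intro norm(3)) auto
      moreover have "lp_norm p n a / D < lp_norm p n a / C" using R C D by (simp add: frac_less2)
      ultimately show False using lower[of a] by simp
    qed
    let ?e = "\<lambda>k::nat. if k = 1 then 1 else (0 :: real)"
    have e: "(\<Sum>k=1..n. modular y (\<bar>?e k\<bar> / v)) = modular y (1 / v)" for v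
    proof -
      have "(\<Sum>k=1..n. modular y (\<bar>?e k\<bar> / v)) = (\<Sum>k=1..n. if k = 1 then modular y (1 / v) else 0)"
        by (intro sum.cong) (auto simp: modular_zero)
      then show ?thesis using n by simp
    qed
    have "modular y (1 / D) \<le> 1" "1 < modular y D"
      using le1[of ?e] gt1[of ?e] unfolding e unit[OF n] by simp_all
    moreover have "real n * modular y (1 / (D * lp_norm p n (\<lambda>_. 1))) \<le> 1"
      "1 < real n * modular y (D / lp_norm p n (\<lambda>_. 1))"
      using le1[of "\<lambda>_. 1"] gt1[of "\<lambda>_. 1"] ones_pos[OF n] by simp_all
    ultimately show ?thesis using summ by blast
  qed
  then show ?thesis using that D by blast
qed

lemma modular_terms_le_one:
  assumes summ: "\<forall>t\<ge>0. summable (\<lambda>i. N (t * \<bar>y i\<bar>))" and D: "1 \<le> D" and le: "modular y (1 / D) \<le> 1"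
  shows "\<bar>y i\<bar> / D \<le> 1"
proof -
  have "summable (\<lambda>i. N (1 / D * \<bar>y i\<bar>))" by (rule summ[rule_format]) (use D in simp)
  then have "(\<Sum>i\<in>{i}. N (1 / D * \<bar>y i\<bar>)) \<le> modular y (1 / D)"
    unfolding modular_def by (rule sum_le_suminf) (use D N_nonneg in auto)
  then have "N (\<bar>y i\<bar> / D) \<le> N 1" using le N_one by simp
  then show ?thesis using D by (subst (asm) N_le_iff) auto
qed

text \<open>The upper estimate holds termwise in the modular, so passing from scale 1/D to D/R with
  R = n^(1/p) leaves at most a multiple of n^(-q/p). As q > p, this falls below 1/n.\<close>

lemma no_crude_if_upper_power:
  assumes low: "lower_power r" and q: "upper_power q" "p < q" and p: "1 \<le> p"
  shows "\<not> crude_sym_fin_rep N (ereal p)"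
proof
  assume crude: "crude_sym_fin_rep N (ereal p)"
  have p_ereal: "1 \<le> ereal p" using p by simp
  obtain D where D: "1 \<le> D" and ex: "\<And>n. 1 \<le> n \<Longrightarrow> \<exists>y. (\<forall>t\<ge>0. summable (\<lambda>i. N (t * \<bar>y i\<bar>))) \<and>
    modular y (1 / D) \<le> 1 \<and> 1 < modular y D \<and>
    real n * modular y (1 / (D * lp_norm p n (\<lambda>_. 1))) \<le> 1 \<and>
    1 < real n * modular y (D / lp_norm p n (\<lambda>_. 1))"
    by (rule crude_sym_fin_rep_modular[OF low crude p_ereal]) (rule that)
  obtain A where A: "0 < A"
    and *: "\<And>s t. 0 < s \<Longrightarrow> s \<le> 1 \<Longrightarrow> 0 < t \<Longrightarrow> t \<le> 1 \<Longrightarrow> N (s * t) \<le> A * t powr q * N s"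
    using q(1) unfolding upper_power_def by blast
  have q0: "0 < q" using p q by simp
  \<comment> \<open>\<open>n1\<close> puts the ratio t of the two scales into (0,1], where the
    estimate applies; \<open>n2\<close> makes n A t^q less than 1.\<close>
  obtain n1 where n1: "\<And>n. n \<ge> n1 \<Longrightarrow> D\<^sup>2 < real n powr (1 / p)"
    using exists_powr_gt[of "1 / p"] p by auto
  obtain n2 where n2: "\<And>n. n \<ge> n2 \<Longrightarrow> A * D\<^sup>2 powr q < real n powr (q / p - 1)"
    using exists_powr_gt[of "q / p - 1"] p q by auto
  define n where "n = max 1 (max n1 n2)"
  have n: "1 \<le> n" by (simp add: n_def)
  define R where "R = real n powr (1 / p)"
  have R: "D\<^sup>2 < R" "lp_norm p n (\<lambda>_. 1) = R" "0 < R"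
    using n1[of n] n p by (auto simp: R_def n_def lp_norm_def)
  obtain y where summ: "\<forall>t\<ge>0. summable (\<lambda>i. N (t * \<bar>y i\<bar>))" and y: "modular y (1 / D) \<le> 1"
    and big: "1 < real n * modular y (D / R)"
    using ex[OF n] R by auto
  note le1 = modular_terms_le_one[OF summ D y]
  have summ_D: "summable (\<lambda>i. N (1 / D * \<bar>y i\<bar>))" by (rule summ[rule_format]) (use D in simp)
  define t where "t = D\<^sup>2 / R"
  have t: "0 < t" "t \<le> 1" using R D by (auto simp: t_def)
  have "modular y (D / R) \<le> (\<Sum>i. A * t powr q * N (1 / D * \<bar>y i\<bar>))"
    unfolding modular_def
  proof (intro suminf_le summable_mult)
    fix i
    show "N (D / R * \<bar>y i\<bar>) \<le> A * t powr q * N (1 / D * \<bar>y i\<bar>)"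
    proof (cases "y i = 0")
      case False
      have "D / R * \<bar>y i\<bar> = (\<bar>y i\<bar> / D) * t" using D by (simp add: t_def power2_eq_square)
      then show ?thesis using *[of "\<bar>y i\<bar> / D" t] False le1[of i] t D by simp
    qed (simp add: N_zero)
  qed (rule summ[rule_format], use D R in simp)+
  also have "\<dots> = A * t powr q * modular y (1 / D)"
    unfolding modular_def using summ_D by (rule suminf_mult)
  also have "\<dots> \<le> A * t powr q" using y A by (intro mult_left_le) auto
  finally have "real n * modular y (D / R) \<le> real n * (A * t powr q)" by (intro mult_left_mono) auto
  also have "t powr q = D\<^sup>2 powr q / real n powr (q / p)"
    using D R by (simp add: t_def powr_divide R_def powr_powr)
  also have "real n * (A * (D\<^sup>2 powr q / real n powr (q / p))) = A * D\<^sup>2 powr q / real n powr (q / p - 1)"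
    using n by (simp add: powr_diff)
  also have "\<dots> < 1" using n2[of n] n by (simp add: n_def)
  finally show False using big by simp
qed

text \<open>The modular exceeds 1 at D, hence 1/K at 1/D by dilation. The lower estimate carries
  this to scale 1/(D R), with R the norm of the all-ones vector, leaving at least a multiple of
  R^(-q), which exceeds 1/n for suitable n.\<close>

lemma no_crude_if_lower_power:
  assumes low: "lower_power q" and q: "0 < q" "ereal q < p" and p: "1 \<le> p"
  shows "\<not> crude_sym_fin_rep N p"
proof
  assume crude: "crude_sym_fin_rep N p"
  obtain D where D: "1 \<le> D" and ex: "\<And>n. 1 \<le> n \<Longrightarrow> \<exists>y. (\<forall>t\<ge>0. summable (\<lambda>i. N (t * \<bar>y i\<bar>))) \<and>
    modular y (1 / D) \<le> 1 \<and> 1 < modular y D \<and>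
    real n * modular y (1 / (D * lp_norm p n (\<lambda>_. 1))) \<le> 1 \<and>
    1 < real n * modular y (D / lp_norm p n (\<lambda>_. 1))"
    by (rule crude_sym_fin_rep_modular[OF low crude p]) (rule that)
  obtain A where A: "0 < A"
    and *: "\<And>s t. 0 < s \<Longrightarrow> s \<le> 1 \<Longrightarrow> 0 < t \<Longrightarrow> t \<le> 1 \<Longrightarrow> A * t powr q * N s \<le> N (s * t)"
    using low unfolding lower_power_def by blast
  obtain K where K: "0 < K" "\<And>z. 0 \<le> z \<Longrightarrow> z \<le> 1 \<Longrightarrow> N (D\<^sup>2 * z) \<le> K * N z"
    using dilation_bound[OF low, of "D\<^sup>2"] D by auto
  define L where "L n = lp_norm p n (\<lambda>_. 1)" for n
  \<comment> \<open>The quotient is n^(1 - q/p) for finite p, and n itself for p = infinity, where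
    \<open>L n\<close> is 1.\<close>
  have "\<exists>n\<ge>1. K / A < real n / L n powr q \<and> 1 \<le> L n"
  proof (cases p)
    case (real p')
    have p': "1 \<le> p'" "q < p'" using real p q by auto
    obtain n0 where n0: "\<And>n. n \<ge> n0 \<Longrightarrow> K / A < real n powr (1 - q / p')"
      using exists_powr_gt[of "1 - q / p'"] p' by auto
    define n where "n = max 1 n0"
    have n: "1 \<le> n" "n0 \<le> n" by (auto simp: n_def)
    have L: "L n = real n powr (1 / p')" using real by (simp add: L_def lp_norm_def)
    have "real n powr (1 - q / p') = real n / L n powr q" using n by (simp add: L powr_diff powr_powr)
    moreover have "1 \<le> L n" unfolding L using n p' by (intro ge_one_powr_ge_zero) auto
    ultimately show ?thesis using n0[OF n(2)] n by auto
  next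
    case PInf
    obtain n0 :: nat where n0: "K / A < real n0" using reals_Archimedean2 by blast
    have L: "L n = 1" if "1 \<le> n" for n
    proof -
      have "((\<lambda>k. \<bar>1 :: real\<bar>) ` {1..n}) = {1}" using that by auto
      then show ?thesis using PInf by (simp add: L_def lp_norm_def)
    qed
    show ?thesis using n0 by (intro exI[of _ "max 1 n0"]) (simp add: L)
  qed (use p in auto)
  then obtain n where n: "1 \<le> n" "K / A < real n / L n powr q" "1 \<le> L n" by blast
  obtain y where summ: "\<forall>t\<ge>0. summable (\<lambda>i. N (t * \<bar>y i\<bar>))" and y: "modular y (1 / D) \<le> 1"
    and yD: "1 < modular y D" and small: "real n * modular y (1 / (D * L n)) \<le> 1"
    using ex[OF n(1)] unfolding L_def by blast
  note le1 = modular_terms_le_one[OF summ D y]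
  have summ_D: "summable (\<lambda>i. N (1 / D * \<bar>y i\<bar>))" by (rule summ[rule_format]) (use D in simp)
  define t where "t = 1 / L n"
  have t: "0 < t" "t \<le> 1" using n by (auto simp: t_def)
  have "modular y D \<le> (\<Sum>i. K * N (1 / D * \<bar>y i\<bar>))"
    unfolding modular_def
  proof (intro suminf_le summable_mult)
    fix i
    have "D * \<bar>y i\<bar> = D\<^sup>2 * (\<bar>y i\<bar> / D)" using D by (simp add: power2_eq_square)
    then show "N (D * \<bar>y i\<bar>) \<le> K * N (1 / D * \<bar>y i\<bar>)" using K(2)[of "\<bar>y i\<bar> / D"] le1[of i] D by simp
  qed (rule summ[rule_format], use D in simp)+
  also have "\<dots> = K * modular y (1 / D)"
    unfolding modular_def using summ_D by (rule suminf_mult)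
  finally have "1 / K < modular y (1 / D)" using yD K by (simp add: field_simps)
  then have "A * t powr q * (1 / K) < A * t powr q * modular y (1 / D)"
    using A t by (intro mult_strict_left_mono) auto
  also have "\<dots> = (\<Sum>i. A * t powr q * N (1 / D * \<bar>y i\<bar>))"
    unfolding modular_def using summ_D by (rule suminf_mult[symmetric])
  also have "\<dots> \<le> modular y (1 / (D * L n))"
    unfolding modular_def
  proof (intro suminf_le summable_mult)
    fix i
    show "A * t powr q * N (1 / D * \<bar>y i\<bar>) \<le> N (1 / (D * L n) * \<bar>y i\<bar>)"
    proof (cases "y i = 0")
      case False
      have "1 / (D * L n) * \<bar>y i\<bar> = (\<bar>y i\<bar> / D) * t" by (simp add: t_def)
      then show ?thesis using *[of "\<bar>y i\<bar> / D" t] False le1[of i] t D by simp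
    qed (simp add: N_zero)
  qed (rule summ[rule_format], use D n in simp)+
  finally have "real n * (A * t powr q * (1 / K)) < real n * modular y (1 / (D * L n))"
    using n by (intro mult_strict_left_mono) auto
  then have "real n * (A * t powr q * (1 / K)) < 1" using small by linarith
  moreover have "t powr q = 1 / L n powr q" using n by (simp add: t_def powr_divide)
  ultimately have "real n / L n powr q < K / A" using A K n by (simp add: field_simps)
  then show False using n by simp
qed

text \<open>At s = 1 both estimates compare N(t) with a power of t; let t = 1/n tend to 0.\<close>

lemma lower_power_le_upper_power_exponent:
  assumes low: "lower_power a" and up: "upper_power b"
  shows "b \<le> a"
proof (rule ccontr)
  assume ba: "\<not> b \<le> a"
  obtain A where A: "0 < A"
    and lowA: "\<And>s t. 0 < s \<Longrightarrow> s \<le> 1 \<Longrightarrow> 0 < t \<Longrightarrow> t \<le> 1 \<Longrightarrow> A * t powr a * N s \<le> N (s * t)"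
    using low unfolding lower_power_def by blast
  obtain B where B: "0 < B"
    and upB: "\<And>s t. 0 < s \<Longrightarrow> s \<le> 1 \<Longrightarrow> 0 < t \<Longrightarrow> t \<le> 1 \<Longrightarrow> N (s * t) \<le> B * t powr b * N s"
    using up unfolding upper_power_def by blast
  obtain n0 where n0: "\<And>n. n \<ge> n0 \<Longrightarrow> B / A < real n powr (b - a)"
    using exists_powr_gt[of "b - a"] ba by auto
  define n where "n = max 1 n0"
  have n: "1 \<le> n" "n0 \<le> n" by (auto simp: n_def)
  define t where "t = 1 / real n"
  have t: "0 < t" "t \<le> 1" using n by (auto simp: t_def)
  have "A * t powr a \<le> B * t powr b" using lowA[of 1 t] upB[of 1 t] t N_one by simp
  then have "real n powr (b - a) \<le> B / A" using A n by (simp add: t_def powr_divide powr_diff field_simps)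
  then show False using n0[OF n(2)] by simp
qed

text \<open>The exponent r gives alpha >= 1/r. If beta were not positive, every positive exponent
  would admit an upper estimate, even r + 1. Hence \<open>recip_ereal\<close> is an ordinary
  reciprocal at both indices.\<close>

lemma boyd_indices_positive:
  assumes low: "lower_power r" and r: "0 < r"
  shows "0 < boyd_alpha N" "0 < boyd_beta N"
proof -
  show "0 < boyd_alpha N" by (rule less_le_trans[OF _ alpha_ge_if_lower_power[OF r low]]) (use r in simp)
  show "0 < boyd_beta N"
  proof (rule ccontr)
    assume "\<not> 0 < boyd_beta N"
    moreover have "0 < 1 / (r + 1)" using r by simp
    ultimately have "boyd_beta N < 1 / (r + 1)" by linarith
    then have "upper_power (r + 1)" using r by (intro upper_power_if_beta) auto
    then show False using lower_power_le_upper_power_exponent[OF low] by fastforce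
  qed
qed

lemma boyd_interval_if_crude:
  assumes low: "lower_power r" and r: "0 < r" and crude: "crude_sym_fin_rep N p" and p: "1 \<le> p"
  shows "recip_ereal (boyd_beta N) \<le> p" "p \<le> recip_ereal (boyd_alpha N)"
proof -
  note pos = boyd_indices_positive[OF low r]
  have recip: "recip_ereal (boyd_beta N) = ereal (1 / boyd_beta N)"
    "recip_ereal (boyd_alpha N) = ereal (1 / boyd_alpha N)"
    using pos by (simp_all add: recip_ereal_def)
  show "recip_ereal (boyd_beta N) \<le> p"
  proof (rule ccontr)
    assume *: "\<not> recip_ereal (boyd_beta N) \<le> p"
    then obtain p' where p': "p = ereal p'" using p by (cases p) auto
    have "p' < 1 / boyd_beta N" "1 \<le> p'" using * p unfolding recip p' by (auto simp: not_le)
    then obtain q where q: "p' < q" "q < 1 / boyd_beta N" using dense by blast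
    have "boyd_beta N < 1 / q" using q \<open>1 \<le> p'\<close> pos by (simp add: field_simps)
    then have "upper_power q" using q \<open>1 \<le> p'\<close> by (intro upper_power_if_beta) auto
    then show False using no_crude_if_upper_power[OF low _ q(1) \<open>1 \<le> p'\<close>] crude p' by simp
  qed
  show "p \<le> recip_ereal (boyd_alpha N)"
  proof (rule ccontr)
    assume "\<not> p \<le> recip_ereal (boyd_alpha N)"
    then have "ereal (1 / boyd_alpha N) < p" unfolding recip by simp
    then obtain q where q: "ereal (1 / boyd_alpha N) < ereal q" "ereal q < p"
      using ereal_dense2 by blast
    have q0: "1 / boyd_alpha N < q" using q by simp
    have "0 < 1 / boyd_alpha N" using pos by simp
    then have "0 < q" using q0 by linarith
    have "1 / q < boyd_alpha N" using q0 \<open>0 < q\<close> pos by (simp add: field_simps)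
    then have "lower_power q" using \<open>0 < q\<close> by (intro lower_power_if_alpha) auto
    then show False using no_crude_if_lower_power[OF _ \<open>0 < q\<close> q(2) p] crude by blast
  qed
qed

lemma sym_block_fin_rep_if_boyd_interval:
  assumes low: "lower_power r" and r: "0 < r" and p: "1 \<le> p"
    and int: "recip_ereal (boyd_beta N) \<le> p" "p \<le> recip_ereal (boyd_alpha N)"
  shows "sym_block_fin_rep N p"
proof -
  note pos = boyd_indices_positive[OF low r]
  \<comment> \<open>Since alpha > 0, the right end of the interval is finite, so p = infinity cannot
    occur.\<close>
  obtain p' where p': "p = ereal p'"
    using p int(2) pos by (cases p) (auto simp: recip_ereal_def)
  have ge: "1 \<le> p'" using p p' by simp
  have "1 / boyd_beta N \<le> p'" "p' \<le> 1 / boyd_alpha N"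
    using int pos unfolding p' by (simp_all add: recip_ereal_def)
  then have bnd: "1 / p' \<le> boyd_beta N" "boyd_alpha N \<le> 1 / p'"
    using pos ge by (simp_all add: field_simps)
  have "\<not> upper_power q" if q: "p' < q" for q
  proof
    assume "upper_power q"
    then have "boyd_beta N \<le> 1 / q" using q ge by (intro beta_le_if_upper_power) auto
    moreover have "1 / q < 1 / p'" using q ge by (intro divide_strict_left_mono) auto
    ultimately show False using bnd by linarith
  qed
  moreover have "\<not> lower_power q" if q: "0 < q" "q < p'" for q
  proof
    assume "lower_power q"
    then have "1 / q \<le> boyd_alpha N" using q by (intro alpha_ge_if_lower_power) auto
    moreover have "1 / p' < 1 / q" using q ge by (intro divide_strict_left_mono) auto
    ultimately show False using bnd by linarith
  qed
  ultimately show ?thesis unfolding p' using ge by (intro sym_block_fin_rep_if_no_powers) auto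
qed

end

theorem theorem6p2:
  fixes N :: "real \<Rightarrow> real" and r :: real and p :: ereal
  assumes "orlicz_function N" and "N 1 = 1" and "r > 0"
    and "(INF st\<in>{0<..1} \<times> {0<..1}. N (fst st * snd st) / (N (fst st) * snd st powr r)) > 0"
    and "1 \<le> p"
  shows "(sym_block_fin_rep N p \<longleftrightarrow> sym_fin_rep N p) \<and>
         (sym_fin_rep N p \<longleftrightarrow> crude_sym_fin_rep N p) \<and>
         (crude_sym_fin_rep N p \<longleftrightarrow>
            (recip_ereal (boyd_beta N) \<le> p \<and> p \<le> recip_ereal (boyd_alpha N)))"
proof -
  define c where "c = (INF st\<in>{0<..1} \<times> {0<..1}. N (fst st * snd st) / (N (fst st) * snd st powr r))"
  have nonneg: "0 \<le> N x" if "0 \<le> x" for x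
    using assms(1) that unfolding orlicz_function_def mono_on_def by force
  have quot: "c \<le> N (s * t) / (N s * t powr r)" if "0 < s" "s \<le> 1" "0 < t" "t \<le> 1" for s t
  proof -
    \<comment> \<open>A real infimum is known to lie below the values only when the set is bounded
      below; nonnegativity of N provides this before its positivity is known.\<close>
    have "bdd_below ((\<lambda>st. N (fst st * snd st) / (N (fst st) * snd st powr r)) ` ({0<..1} \<times> {0<..1}))"
    proof (rule bdd_belowI2[where m = 0])
      fix st :: "real \<times> real" assume "st \<in> {0<..1} \<times> {0<..1}"
      then have "0 \<le> fst st" "0 \<le> snd st" by auto
      then show "0 \<le> N (fst st * snd st) / (N (fst st) * snd st powr r)"
        by (intro divide_nonneg_nonneg mult_nonneg_nonneg nonneg) simp_all
    qed
    from cINF_lower[OF this, of "(s, t)"] show ?thesis unfolding c_def using that by simp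
  qed
  have c: "0 < c" using assms(4) by (simp add: c_def)
  have pos: "0 < N s" if s: "0 < s" "s \<le> 1" for s
  proof -
    \<comment> \<open>If \<open>N s = 0\<close> the quotient has the junk value 0, contradicting the positive infimum.\<close>
    have "N s \<noteq> 0" using quot[of s 1] s c by auto
    then show ?thesis using nonneg[of s] s by simp
  qed
  interpret normalized_orlicz N by unfold_locales (use assms pos in auto)
  have low: "lower_power r"
    unfolding lower_power_def
  proof (intro exI[of _ c] conjI allI impI c)
    fix s t :: real assume "0 < s" "s \<le> 1" "0 < t" "t \<le> 1"
    then show "c * t powr r * N s \<le> N (s * t)"
      using quot[of s t] pos[of s] by (simp add: field_simps)
  qed
  have "sym_block_fin_rep N p \<Longrightarrow> sym_fin_rep N p"
    by (rule sym_fin_rep_if_sym_block_fin_rep)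
  moreover have "sym_fin_rep N p \<Longrightarrow> crude_sym_fin_rep N p"
    by (rule crude_sym_fin_rep_if_sym_fin_rep)
  moreover have "crude_sym_fin_rep N p \<Longrightarrow>
      recip_ereal (boyd_beta N) \<le> p \<and> p \<le> recip_ereal (boyd_alpha N)"
    by (intro conjI; rule boyd_interval_if_crude[OF low assms(3) _ assms(5)])
  moreover have "recip_ereal (boyd_beta N) \<le> p \<Longrightarrow> p \<le> recip_ereal (boyd_alpha N) \<Longrightarrow>
      sym_block_fin_rep N p"
    by (rule sym_block_fin_rep_if_boyd_interval[OF low assms(3,5)])
  ultimately show ?thesis by argo
qed

end
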